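(* Let $\mathcal{D}$ be a well generated triangulated category, let $\omega$ be a partial silting object in $\mathcal{D}$, and consider the associated recollement with outer terms $\omega^{\perp_{\mathbb{Z}}}$ and $\mathrm{Loc}(\omega)$, with functors $i^*, i_*, i^!$ (between $\omega^{\perp_{\mathbb{Z}}}$ and $\mathcal{D}$) and $j_!, j^*, j_*$ (between $\mathrm{Loc}(\omega)$ and $\mathcal{D}$), where $i_*$ and $j_!$ are the inclusions. Let $\sigma$ be a silting object in $\omega^{\perp_{\mathbb{Z}}}$. Assume that (1) the class $(i_*\sigma)^{\perp_{>0}} \cap (j_!\omega)^{\perp_{>0}}$ is closed under coproducts in $\mathcal{D}$; (2) $\mathrm{Hom}_{\mathcal{D}}(i_*\sigma, j_!\omega[k]) = 0$ for all integers $k \geq 2$. Let $I = \mathrm{Hom}_{\mathcal{D}}(i_*\sigma, j_!\omega[1])$ (as a set), let $\alpha\colon i_*\sigma^{(I)} \to j_!\omega[1]$ be the canonically induced map (whose component at $f\in I$ is $f$), and let $\tilde\sigma$ be the cocone of $\alpha$, so that there is a triangle $$j_!\omega \to \tilde{\sigma} \to i_*\sigma^{(I)} \xrightarrow{\alpha} j_!\omega[1].$$ Then $\tilde{\sigma} \oplus i_*\sigma$ is a silting object in $\mathcal{D}$.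
   Context: Well generated is meant in the sense of Neeman/Krause: $\mathcal{D}$ has set-indexed coproducts and, for some regular cardinal $\alpha$, a set $\mathcal{S}$ of $\alpha$-small objects with $\mathcal{S}^{\perp_{\mathbb{Z}}}=0$ such that, for every set of maps $(g_\lambda)$ in $\mathcal{D}$, if $\mathrm{Hom}(S,g_\lambda)$ is surjective for all $\lambda$ and all $S\in\mathcal{S}$, then $\mathrm{Hom}(S,\coprod g_\lambda)$ is surjective for all $S\in\mathcal S$. For an object $X$ of a triangulated category $\mathcal{T}$ and a set $I$ of integers (written e.g. $>0$, $\le 0$, $\mathbb{Z}$), $X^{\perp_I}=\{Y\in\mathcal{T} : \mathrm{Hom}_{\mathcal{T}}(X,Y[i])=0 \text{ for all } i\in I\}$. $X^{(J)}$ denotes the coproduct of $J$ copies of $X$. $\mathrm{Loc}(\omega)$ is the smallest triangulated subcategory containing $\omega$ and closed under coproducts. A torsion pair $(\mathcal{U},\mathcal{V})$ is a pair of full subcategories closed under summands with $\mathrm{Hom}(\mathcal{U},\mathcal{V})=0$ such that every object $X$ lies in a triangle $U\to X\to V\to U[1]$ with $U\in\mathcal{U}$, $V\in\mathcal{V}$; it is a t-structure if $\mathcal{U}$ is closed under positive shifts and extensions. An object $\sigma$ is silting if $(\sigma^{\perp_{>0}},\sigma^{\perp_{\le 0}})$ is a t-structure. In a well generated triangulated category, $\omega$ is partial silting if $\omega\in\omega^{\perp_{>0}}$ and $\omega^{\perp_{>0}}$ is closed under coproducts; silting is equivalent to partial silting together with $\omega^{\perp_{\mathbb{Z}}}=0$.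 For $\omega$ partial silting, $\mathrm{Loc}(\omega)$ is smashing, $\omega$ is silting in $\mathrm{Loc}(\omega)$, both $\mathrm{Loc}(\omega)$ and $\omega^{\perp_{\mathbb Z}}$ are well generated, and there is a recollement $$\omega^{\perp_{\mathbb{Z}}} \xrightarrow{\ i_*\ } \mathcal{D} \xrightarrow{\ j^*\ } \mathrm{Loc}(\omega)$$ with $i_*$ the inclusion, $j_!\colon \mathrm{Loc}(\omega)\to\mathcal{D}$ the inclusion, and adjoint pairs $(i^*,i_* ),(i_*,i^!),(j_!,j^* ),(j^*,j_* )$, where $i_*,j_!,j_*$ are fully faithful and $i^!j_*=0$. *)

theory Defs
  imports Main
begin

unbundle cardinal_syntax

section \<open>Set-theoretic size\<close>

text \<open>
  "Set-indexed" is interpreted relative to a universe, given by a set \<open>U\<close> whose cardinality is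
  strongly inaccessible: a set (over any type) counts as small iff its cardinality is smaller
  than that of \<open>U\<close>. Since the Grothendieck universe \<open>V_\<kappa>\<close> of an inaccessible \<open>\<kappa>\<close> has
  cardinality \<open>\<kappa>\<close>, and its elements are up to bijection the sets of cardinality less than \<open>\<kappa>\<close>,
  this is the usual notion. Objects and morphisms of a category may form classes, i.e. no bound is
  put on them. Every small set is in bijection with a subset of \<open>U\<close>, so small families may be
  indexed by small sets over the element type of \<open>U\<close>.
\<close>

definition small :: "'u set \<Rightarrow> 'a set \<Rightarrow> bool" where
  "small U A \<longleftrightarrow> |A| <o |U|"

definition inaccessible :: "'u set \<Rightarrow> bool" where
  "inaccessible U \<longleftrightarrow>
     natLeq <o |U| \<and> regularCard |U| \<and> (\<forall>A::'u set. small U A \<longrightarrow> small U (Pow A))"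


section \<open>Triangulated categories\<close>

text \<open>
  Arrows carry their domain and codomain, so hom-sets are disjoint. \<open>Sh\<close> and \<open>ShM\<close> are the shift
  on objects and on arrows. A triangle \<open>X \<rightarrow> Y \<rightarrow> Z \<rightarrow> X[1]\<close> is recorded by its three arrows.
\<close>

record ('o, 'm) tricat =
  Ob   :: "'o set"
  Mor  :: "'m set"
  Dom  :: "'m \<Rightarrow> 'o"
  Cod  :: "'m \<Rightarrow> 'o"
  Id   :: "'o \<Rightarrow> 'm"
  Comp :: "'m \<Rightarrow> 'm \<Rightarrow> 'm"  (infixr "\<cdot>\<index>" 70)
  Plus :: "'m \<Rightarrow> 'm \<Rightarrow> 'm"  (infixl "\<oplus>\<index>" 65)
  Zero :: "'o \<Rightarrow> 'o \<Rightarrow> 'm"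
  Neg  :: "'m \<Rightarrow> 'm"
  Sh   :: "'o \<Rightarrow> 'o"
  ShM  :: "'m \<Rightarrow> 'm"
  Tri  :: "('m \<times> 'm \<times> 'm) set"

definition Hom :: "('o, 'm) tricat \<Rightarrow> 'o \<Rightarrow> 'o \<Rightarrow> 'm set" where
  "Hom T X Y = {f \<in> Mor T. Dom T f = X \<and> Cod T f = Y}"

definition iso :: "('o, 'm) tricat \<Rightarrow> 'm \<Rightarrow> bool" where
  "iso T f \<longleftrightarrow> f \<in> Mor T \<and>
     (\<exists>g \<in> Hom T (Cod T f) (Dom T f).
        Comp T g f = Id T (Dom T f) \<and> Comp T f g = Id T (Cod T f))"

definition isomorphic :: "('o, 'm) tricat \<Rightarrow> 'o \<Rightarrow> 'o \<Rightarrow> bool" where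
  "isomorphic T X Y \<longleftrightarrow> (\<exists>f \<in> Hom T X Y. iso T f)"

definition zero_object :: "('o, 'm) tricat \<Rightarrow> 'o \<Rightarrow> bool" where
  "zero_object T Z \<longleftrightarrow> Z \<in> Ob T \<and>
     (\<forall>X \<in> Ob T. (\<exists>!f. f \<in> Hom T X Z) \<and> (\<exists>!f. f \<in> Hom T Z X))"

definition direct_sum :: "('o, 'm) tricat \<Rightarrow> 'o \<Rightarrow> 'o \<Rightarrow> 'o \<Rightarrow> bool" where
  "direct_sum T A B S \<longleftrightarrow> A \<in> Ob T \<and> B \<in> Ob T \<and> S \<in> Ob T \<and>
     (\<exists>i \<in> Hom T A S. \<exists>j \<in> Hom T B S. \<exists>p \<in> Hom T S A. \<exists>q \<in> Hom T S B.
        Comp T p i = Id T A \<and> Comp T q j = Id T B \<and>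
        Comp T q i = Zero T A B \<and> Comp T p j = Zero T B A \<and>
        Plus T (Comp T i p) (Comp T j q) = Id T S)"

locale category =
  fixes T :: "('o, 'm) tricat" (structure)
  assumes dom_cod: "f \<in> Mor T \<Longrightarrow> Dom T f \<in> Ob T \<and> Cod T f \<in> Ob T"
    and id_Hom: "X \<in> Ob T \<Longrightarrow> Id T X \<in> Hom T X X"
    and comp_Hom: "\<lbrakk>f \<in> Hom T X Y; g \<in> Hom T Y Z\<rbrakk> \<Longrightarrow> g \<cdot> f \<in> Hom T X Z"
    and id_right: "f \<in> Hom T X Y \<Longrightarrow> f \<cdot> Id T X = f"
    and id_left: "f \<in> Hom T X Y \<Longrightarrow> Id T Y \<cdot> f = f"
    and comp_assoc:
      "\<lbrakk>f \<in> Hom T W X; g \<in> Hom T X Y; h \<in> Hom T Y Z\<rbrakk> \<Longrightarrow> (h \<cdot> g) \<cdot> f = h \<cdot> (g \<cdot> f)"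

locale additive_category = category +
  assumes plus_Hom: "\<lbrakk>f \<in> Hom T X Y; g \<in> Hom T X Y\<rbrakk> \<Longrightarrow> f \<oplus> g \<in> Hom T X Y"
    and zero_Hom: "\<lbrakk>X \<in> Ob T; Y \<in> Ob T\<rbrakk> \<Longrightarrow> Zero T X Y \<in> Hom T X Y"
    and neg_Hom: "f \<in> Hom T X Y \<Longrightarrow> Neg T f \<in> Hom T X Y"
    and plus_assoc:
      "\<lbrakk>f \<in> Hom T X Y; g \<in> Hom T X Y; h \<in> Hom T X Y\<rbrakk> \<Longrightarrow> (f \<oplus> g) \<oplus> h = f \<oplus> (g \<oplus> h)"
    and plus_commute: "\<lbrakk>f \<in> Hom T X Y; g \<in> Hom T X Y\<rbrakk> \<Longrightarrow> f \<oplus> g = g \<oplus> f"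
    and plus_zero: "f \<in> Hom T X Y \<Longrightarrow> f \<oplus> Zero T X Y = f"
    and plus_neg: "f \<in> Hom T X Y \<Longrightarrow> f \<oplus> Neg T f = Zero T X Y"
    and comp_plus_right:
      "\<lbrakk>f \<in> Hom T X Y; g \<in> Hom T X Y; h \<in> Hom T Y Z\<rbrakk> \<Longrightarrow> h \<cdot> (f \<oplus> g) = (h \<cdot> f) \<oplus> (h \<cdot> g)"
    and comp_plus_left:
      "\<lbrakk>f \<in> Hom T X Y; g \<in> Hom T Y Z; h \<in> Hom T Y Z\<rbrakk> \<Longrightarrow> (g \<oplus> h) \<cdot> f = (g \<cdot> f) \<oplus> (h \<cdot> f)"
    and ex_zero_object: "\<exists>Z. zero_object T Z"
    and ex_direct_sum: "\<lbrakk>A \<in> Ob T; B \<in> Ob T\<rbrakk> \<Longrightarrow> \<exists>S. direct_sum T A B S"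

text \<open>The shift is an automorphism (not merely an autoequivalence), so that \<open>X[n]\<close> makes sense
  strictly for every integer \<open>n\<close>.\<close>

locale triangulated_category = additive_category +
  assumes sh_bij: "bij_betw (Sh T) (Ob T) (Ob T)"
    and shM_bij: "bij_betw (ShM T) (Mor T) (Mor T)"
    and shM_Hom: "f \<in> Hom T X Y \<Longrightarrow> ShM T f \<in> Hom T (Sh T X) (Sh T Y)"
    and shM_id: "X \<in> Ob T \<Longrightarrow> ShM T (Id T X) = Id T (Sh T X)"
    and shM_comp:
      "\<lbrakk>f \<in> Hom T X Y; g \<in> Hom T Y Z\<rbrakk> \<Longrightarrow> ShM T (g \<cdot> f) = ShM T g \<cdot> ShM T f"
    and shM_plus:
      "\<lbrakk>f \<in> Hom T X Y; g \<in> Hom T X Y\<rbrakk> \<Longrightarrow> ShM T (f \<oplus> g) = ShM T f \<oplus> ShM T g"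
    and tri_typed:
      "(u, v, w) \<in> Tri T \<Longrightarrow>
         \<exists>X Y Z. u \<in> Hom T X Y \<and> v \<in> Hom T Y Z \<and> w \<in> Hom T Z (Sh T X)"
    and TR1_iso:
      "\<lbrakk>(u, v, w) \<in> Tri T;
        u \<in> Hom T X Y; v \<in> Hom T Y Z; w \<in> Hom T Z (Sh T X);
        u' \<in> Hom T X' Y'; v' \<in> Hom T Y' Z'; w' \<in> Hom T Z' (Sh T X');
        a \<in> Hom T X X'; b \<in> Hom T Y Y'; c \<in> Hom T Z Z'; iso T a; iso T b; iso T c;
        b \<cdot> u = u' \<cdot> a; c \<cdot> v = v' \<cdot> b; ShM T a \<cdot> w = w' \<cdot> c\<rbrakk> \<Longrightarrow> (u', v', w') \<in> Tri T"
    and TR1_id: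
      "\<lbrakk>X \<in> Ob T; zero_object T Z\<rbrakk> \<Longrightarrow> (Id T X, Zero T X Z, Zero T Z (Sh T X)) \<in> Tri T"
    and TR1_cone: "u \<in> Mor T \<Longrightarrow> \<exists>v w. (u, v, w) \<in> Tri T"
    and TR2:
      "\<lbrakk>u \<in> Hom T X Y; v \<in> Hom T Y Z; w \<in> Hom T Z (Sh T X)\<rbrakk> \<Longrightarrow>
         (u, v, w) \<in> Tri T \<longleftrightarrow> (v, w, Neg T (ShM T u)) \<in> Tri T"
    and TR3:
      "\<lbrakk>(u, v, w) \<in> Tri T; (u', v', w') \<in> Tri T;
        u \<in> Hom T X Y; v \<in> Hom T Y Z; w \<in> Hom T Z (Sh T X);
        u' \<in> Hom T X' Y'; v' \<in> Hom T Y' Z'; w' \<in> Hom T Z' (Sh T X');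
        a \<in> Hom T X X'; b \<in> Hom T Y Y'; b \<cdot> u = u' \<cdot> a\<rbrakk> \<Longrightarrow>
         \<exists>c \<in> Hom T Z Z'. c \<cdot> v = v' \<cdot> b \<and> ShM T a \<cdot> w = w' \<cdot> c"
    and TR4:
      "\<lbrakk>(u, j, k) \<in> Tri T; (v, l, i) \<in> Tri T; (v \<cdot> u, m, n) \<in> Tri T;
        u \<in> Hom T X Y; j \<in> Hom T Y Z'; k \<in> Hom T Z' (Sh T X);
        v \<in> Hom T Y Z; l \<in> Hom T Z X'; i \<in> Hom T X' (Sh T Y);
        m \<in> Hom T Z Y'; n \<in> Hom T Y' (Sh T X)\<rbrakk> \<Longrightarrow>
         \<exists>f \<in> Hom T Z' Y'. \<exists>g \<in> Hom T Y' X'.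
           (f, g, ShM T j \<cdot> i) \<in> Tri T \<and>
           n \<cdot> f = k \<and> g \<cdot> m = l \<and> f \<cdot> j = m \<cdot> v \<and> i \<cdot> g = ShM T u \<cdot> n"

definition shift :: "('o, 'm) tricat \<Rightarrow> int \<Rightarrow> 'o \<Rightarrow> 'o" where
  "shift T n X =
     (if 0 \<le> n then (Sh T ^^ nat n) X else (inv_into (Ob T) (Sh T) ^^ nat (- n)) X)"

definition perp :: "('o, 'm) tricat \<Rightarrow> 'o \<Rightarrow> int set \<Rightarrow> 'o set" where
  "perp T X I = {Y \<in> Ob T. \<forall>i \<in> I. Hom T X (shift T i Y) = {Zero T X (shift T i Y)}}"

definition full_sub :: "('o, 'm) tricat \<Rightarrow> 'o set \<Rightarrow> ('o, 'm) tricat" where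
  "full_sub T S =
     (let M = {f \<in> Mor T. Dom T f \<in> S \<and> Cod T f \<in> S}
      in T\<lparr>Ob := S, Mor := M, Tri := Tri T \<inter> (M \<times> M \<times> M)\<rparr>)"

definition triangulated_subcategory :: "('o, 'm) tricat \<Rightarrow> 'o set \<Rightarrow> bool" where
  "triangulated_subcategory T S \<longleftrightarrow> S \<subseteq> Ob T \<and> (\<exists>Z \<in> S. zero_object T Z) \<and>
     (\<forall>X \<in> S. \<forall>Y \<in> Ob T. isomorphic T X Y \<longrightarrow> Y \<in> S) \<and>
     (\<forall>X \<in> S. \<forall>n. shift T n X \<in> S) \<and>
     (\<forall>(u, v, w) \<in> Tri T. Dom T u \<in> S \<and> Cod T u \<in> S \<longrightarrow> Cod T v \<in> S)"


section \<open>Coproducts and well generated categories\<close>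

definition coproduct ::
  "('o, 'm) tricat \<Rightarrow> 'i set \<Rightarrow> ('i \<Rightarrow> 'o) \<Rightarrow> 'o \<Rightarrow> ('i \<Rightarrow> 'm) \<Rightarrow> bool" where
  "coproduct T J X C \<iota> \<longleftrightarrow> C \<in> Ob T \<and> (\<forall>j \<in> J. X j \<in> Ob T \<and> \<iota> j \<in> Hom T (X j) C) \<and>
     (\<forall>Z \<in> Ob T. \<forall>h. (\<forall>j \<in> J. h j \<in> Hom T (X j) Z) \<longrightarrow>
        (\<exists>!f. f \<in> Hom T C Z \<and> (\<forall>j \<in> J. Comp T f (\<iota> j) = h j)))"

definition has_coproducts :: "'u set \<Rightarrow> ('o, 'm) tricat \<Rightarrow> bool" where
  "has_coproducts U T \<longleftrightarrow>
     (\<forall>(J :: 'u set) X. small U J \<and> (\<forall>j \<in> J. X j \<in> Ob T) \<longrightarrow> (\<exists>C \<iota>. coproduct T J X C \<iota>))"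

definition closed_under_coproducts :: "'u set \<Rightarrow> ('o, 'm) tricat \<Rightarrow> 'o set \<Rightarrow> bool" where
  "closed_under_coproducts U T S \<longleftrightarrow>
     (\<forall>(J :: 'u set) X C \<iota>.
        small U J \<and> (\<forall>j \<in> J. X j \<in> S) \<and> coproduct T J X C \<iota> \<longrightarrow> C \<in> S)"

text \<open>Every map from \<open>S\<close> to a coproduct factors through a subcoproduct of fewer than \<open>\<alpha>\<close>
  factors; \<open>e\<close> is the canonical map from the subcoproduct.\<close>

definition alpha_small :: "'u set \<Rightarrow> ('o, 'm) tricat \<Rightarrow> 'u rel \<Rightarrow> 'o \<Rightarrow> bool" where
  "alpha_small U T \<alpha> S \<longleftrightarrow>
     (\<forall>(J :: 'u set) X C \<iota>. \<forall>f \<in> Hom T S C. small U J \<and> coproduct T J X C \<iota> \<longrightarrow>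
        (\<exists>J' \<subseteq> J. |J'| <o \<alpha> \<and>
          (\<exists>C' \<iota>'. coproduct T J' X C' \<iota>' \<and>
            (\<exists>e \<in> Hom T C' C. (\<forall>j \<in> J'. Comp T e (\<iota>' j) = \<iota> j) \<and>
              (\<exists>h \<in> Hom T S C'. f = Comp T e h)))))"

definition Hom_surj :: "('o, 'm) tricat \<Rightarrow> 'o \<Rightarrow> 'm \<Rightarrow> bool" where
  "Hom_surj T S g \<longleftrightarrow> (\<lambda>f. Comp T g f) ` Hom T S (Dom T g) = Hom T S (Cod T g)"

definition well_generated :: "'u set \<Rightarrow> ('o, 'm) tricat \<Rightarrow> bool" where
  "well_generated U T \<longleftrightarrow>
     triangulated_category T \<and>
     (\<forall>X \<in> Ob T. \<forall>Y \<in> Ob T. small U (Hom T X Y)) \<and>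
     has_coproducts U T \<and>
     (\<exists>(\<alpha> :: 'u rel) \<S>.
        Cinfinite \<alpha> \<and> regularCard \<alpha> \<and> \<alpha> <o |U| \<and>
        \<S> \<subseteq> Ob T \<and> small U \<S> \<and> (\<forall>S \<in> \<S>. alpha_small U T \<alpha> S) \<and>
        (\<forall>Y \<in> Ob T. (\<forall>S \<in> \<S>. Y \<in> perp T S UNIV) \<longrightarrow> zero_object T Y) \<and>
        (\<forall>(\<Lambda> :: 'u set) X Y g C \<iota> C' \<iota>' G.
           small U \<Lambda> \<and> (\<forall>l \<in> \<Lambda>. g l \<in> Hom T (X l) (Y l)) \<and>
           coproduct T \<Lambda> X C \<iota> \<and> coproduct T \<Lambda> Y C' \<iota>' \<and>
           G \<in> Hom T C C' \<and> (\<forall>l \<in> \<Lambda>. Comp T G (\<iota> l) = Comp T (\<iota>' l) (g l)) \<and>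
           (\<forall>l \<in> \<Lambda>. \<forall>S \<in> \<S>. Hom_surj T S (g l))
           \<longrightarrow> (\<forall>S \<in> \<S>. Hom_surj T S G)))"

definition Loc :: "'u set \<Rightarrow> ('o, 'm) tricat \<Rightarrow> 'o \<Rightarrow> 'o set" where
  "Loc U T \<omega> =
     \<Inter> {S. triangulated_subcategory T S \<and> closed_under_coproducts U T S \<and> \<omega> \<in> S}"


section \<open>Silting objects\<close>

definition closed_under_summands :: "('o, 'm) tricat \<Rightarrow> 'o set \<Rightarrow> bool" where
  "closed_under_summands T S \<longleftrightarrow> (\<forall>A B. \<forall>X \<in> S. direct_sum T A B X \<longrightarrow> A \<in> S)"

definition torsion_pair :: "('o, 'm) tricat \<Rightarrow> 'o set \<Rightarrow> 'o set \<Rightarrow> bool" where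
  "torsion_pair T \<U> \<V> \<longleftrightarrow> \<U> \<subseteq> Ob T \<and> \<V> \<subseteq> Ob T \<and>
     closed_under_summands T \<U> \<and> closed_under_summands T \<V> \<and>
     (\<forall>A \<in> \<U>. \<forall>B \<in> \<V>. Hom T A B = {Zero T A B}) \<and>
     (\<forall>X \<in> Ob T. \<exists>A \<in> \<U>. \<exists>B \<in> \<V>.
        \<exists>u \<in> Hom T A X. \<exists>v \<in> Hom T X B. \<exists>w \<in> Hom T B (shift T 1 A). (u, v, w) \<in> Tri T)"

definition t_structure :: "('o, 'm) tricat \<Rightarrow> 'o set \<Rightarrow> 'o set \<Rightarrow> bool" where
  "t_structure T \<U> \<V> \<longleftrightarrow> torsion_pair T \<U> \<V> \<and>
     (\<forall>X \<in> \<U>. \<forall>n > 0. shift T n X \<in> \<U>) \<and>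
     (\<forall>(u, v, w) \<in> Tri T. Dom T u \<in> \<U> \<and> Cod T v \<in> \<U> \<longrightarrow> Cod T u \<in> \<U>)"

definition silting :: "('o, 'm) tricat \<Rightarrow> 'o \<Rightarrow> bool" where
  "silting T \<sigma> \<longleftrightarrow> \<sigma> \<in> Ob T \<and> t_structure T (perp T \<sigma> {0<..}) (perp T \<sigma> {..0})"

definition partial_silting :: "'u set \<Rightarrow> ('o, 'm) tricat \<Rightarrow> 'o \<Rightarrow> bool" where
  "partial_silting U T \<omega> \<longleftrightarrow>
     \<omega> \<in> perp T \<omega> {0<..} \<and> closed_under_coproducts U T (perp T \<omega> {0<..})"


section \<open>Recollements\<close>

record ('o, 'm, 'p, 'n) cat_functor =
  FOb  :: "'o \<Rightarrow> 'p"
  FMor :: "'m \<Rightarrow> 'n"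

definition is_functor ::
  "('o, 'm) tricat \<Rightarrow> ('p, 'n) tricat \<Rightarrow> ('o, 'm, 'p, 'n) cat_functor \<Rightarrow> bool" where
  "is_functor A B F \<longleftrightarrow> (\<forall>X \<in> Ob A. FOb F X \<in> Ob B \<and> FMor F (Id A X) = Id B (FOb F X)) \<and>
     (\<forall>X Y. \<forall>f \<in> Hom A X Y. FMor F f \<in> Hom B (FOb F X) (FOb F Y)) \<and>
     (\<forall>X Y Z. \<forall>f \<in> Hom A X Y. \<forall>g \<in> Hom A Y Z.
        FMor F (Comp A g f) = Comp B (FMor F g) (FMor F f))"

text \<open>A triangle functor commutes with the shift up to a natural isomorphism \<open>\<phi>\<close>.\<close>

definition triangle_functor ::
  "('o, 'm) tricat \<Rightarrow> ('p, 'n) tricat \<Rightarrow> ('o, 'm, 'p, 'n) cat_functor \<Rightarrow> bool" where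
  "triangle_functor A B F \<longleftrightarrow> is_functor A B F \<and>
     (\<forall>X Y. \<forall>f \<in> Hom A X Y. \<forall>g \<in> Hom A X Y.
        FMor F (Plus A f g) = Plus B (FMor F f) (FMor F g)) \<and>
     (\<exists>\<phi>. (\<forall>X \<in> Ob A. \<phi> X \<in> Hom B (FOb F (Sh A X)) (Sh B (FOb F X)) \<and> iso B (\<phi> X)) \<and>
        (\<forall>X Y. \<forall>f \<in> Hom A X Y.
           Comp B (\<phi> Y) (FMor F (ShM A f)) = Comp B (ShM B (FMor F f)) (\<phi> X)) \<and>
        (\<forall>(u, v, w) \<in> Tri A. (FMor F u, FMor F v, Comp B (\<phi> (Dom A u)) (FMor F w)) \<in> Tri B))"

definition adjoint_pair ::
  "('o, 'm) tricat \<Rightarrow> ('p, 'n) tricat \<Rightarrow>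
   ('o, 'm, 'p, 'n) cat_functor \<Rightarrow> ('p, 'n, 'o, 'm) cat_functor \<Rightarrow> bool" where
  "adjoint_pair A B F G \<longleftrightarrow>
     (\<exists>\<phi>. \<forall>X \<in> Ob A. \<forall>Y \<in> Ob B.
        bij_betw (\<phi> X Y) (Hom B (FOb F X) Y) (Hom A X (FOb G Y)) \<and>
        (\<forall>g \<in> Hom B (FOb F X) Y.
           (\<forall>X'. \<forall>f \<in> Hom A X' X.
              \<phi> X' Y (Comp B g (FMor F f)) = Comp A (\<phi> X Y g) f) \<and>
           (\<forall>Y'. \<forall>h \<in> Hom B Y Y'.
              \<phi> X Y' (Comp B h g) = Comp A (FMor G h) (\<phi> X Y g))))"

definition fully_faithful ::
  "('o, 'm) tricat \<Rightarrow> ('p, 'n) tricat \<Rightarrow> ('o, 'm, 'p, 'n) cat_functor \<Rightarrow> bool" where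
  "fully_faithful A B F \<longleftrightarrow>
     (\<forall>X \<in> Ob A. \<forall>Y \<in> Ob A. bij_betw (FMor F) (Hom A X Y) (Hom B (FOb F X) (FOb F Y)))"

definition inclusion ::
  "('o, 'm) tricat \<Rightarrow> ('o, 'm, 'o, 'm) cat_functor \<Rightarrow> bool" where
  "inclusion A F \<longleftrightarrow> (\<forall>X \<in> Ob A. FOb F X = X) \<and> (\<forall>f \<in> Mor A. FMor F f = f)"

text \<open>The six functors are named after their usual symbols:
  \<open>i_us = i^*\<close>, \<open>i_ls = i_*\<close>, \<open>i_ush = i^!\<close>, \<open>j_lsh = j_!\<close>, \<open>j_us = j^*\<close>, \<open>j_ls = j_*\<close>.\<close>

definition recollement where
  "recollement Y D X i_us i_ls i_ush j_lsh j_us j_ls \<longleftrightarrow>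
     triangulated_category Y \<and> triangulated_category D \<and> triangulated_category X \<and>
     triangle_functor D Y i_us \<and> triangle_functor Y D i_ls \<and> triangle_functor D Y i_ush \<and>
     triangle_functor X D j_lsh \<and> triangle_functor D X j_us \<and> triangle_functor X D j_ls \<and>
     adjoint_pair D Y i_us i_ls \<and> adjoint_pair Y D i_ls i_ush \<and>
     adjoint_pair X D j_lsh j_us \<and> adjoint_pair D X j_us j_ls \<and>
     fully_faithful Y D i_ls \<and> fully_faithful X D j_lsh \<and> fully_faithful X D j_ls \<and>
     (\<forall>W \<in> Ob X. zero_object Y (FOb i_ush (FOb j_ls W)))"

end

theory Submission
  imports Defs
begin

text \<open>
  Write \<open>\<sigma>'\<close> for the cocone of \<open>\<alpha>\<close>, let \<open>\<tau> = \<sigma>' \<oplus> \<sigma>\<close>. Since the inclusions \<open>i_ls\<close> and \<open>j_lsh\<close>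
  fix \<open>\<sigma>\<close> and \<open>\<omega>\<close>, everything takes place in the ambient category. The proof has two halves.

  Reduction (\<open>silting_gluing\<close>). From the triangle defining \<open>\<sigma>'\<close>, the class \<open>perp D \<tau> {0<..}\<close>
  equals \<open>perp D \<sigma> {0<..} \<inter> perp D \<omega> {0<..}\<close>, which is closed under coproducts by
  hypothesis. It contains \<open>\<tau>\<close>: in degrees at least two \<open>Hom(\<sigma>, \<sigma>'[k])\<close> vanishes because
  \<open>Hom(\<sigma>, \<omega>[k])\<close> does by hypothesis and \<open>Hom(\<sigma>, \<sigma>I[k])\<close> does since \<open>\<sigma>\<close> is silting, and in degree
  one because moreover every map \<open>\<sigma> \<rightarrow> \<omega>[1]\<close> factors through \<open>\<alpha>\<close>. An object to which no shift of
  \<open>\<tau>\<close> maps nontrivially lies in \<open>perp D \<omega> UNIV\<close> and receives no nonzero map from shifts of \<open>\<sigma>\<close>,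
  hence is zero because \<open>\<sigma>\<close> is silting in that subcategory.

  Criterion (\<open>silting_criterion\<close>). If \<open>\<tau>\<close> lies in \<open>V = perp T \<tau> {0<..}\<close>, the class \<open>V\<close> is closed
  under coproducts, and only the zero object lies in \<open>perp T \<tau> UNIV\<close>, then \<open>\<tau>\<close> is silting. The
  essential point is the construction of truncations, \<open>truncation_triangle\<close>. Given \<open>Z\<close>, let
  \<open>X 0 = Z\<close> and let \<open>X (n + 1)\<close> be the cone of the canonical map to \<open>X n\<close> from a coproduct of copies
  of \<open>\<tau>[n]\<close>, one for each map \<open>\<tau>[n] \<rightarrow> X n\<close>. Then \<open>Hom(\<tau>[n], X (n + 1)) = 0\<close> because the coproduct
  lies in \<open>V[n]\<close> (\<open>kill_maps\<close>). For \<open>m \<ge> N\<close> the cone of \<open>X N \<rightarrow> X m\<close> lies in \<open>V[N + 1]\<close>, and so does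
  the cone of a map from \<open>X N\<close> to the Milnor colimit of the sequence starting at \<open>N\<close>
  (\<open>map_to_hocolim\<close>, which combines three octahedra). For \<open>N = k + 1\<close> this shows that \<open>\<tau>[k]\<close> has no
  nonzero map to that colimit, hence none to the colimit \<open>H\<close> of the full sequence, since initial terms
  do not matter (\<open>orth_hocolim_tail\<close>); for \<open>N = 0\<close> it shows that the cocone of \<open>Z \<rightarrow> H\<close> lies in \<open>V\<close>.
  To obtain \<open>Hom(V, perp T \<tau> {..0}) = 0\<close> as well, the construction is carried out in the smaller
  class \<open>aisle\<close> of objects of \<open>V\<close> for which this orthogonality holds; generation then shows that
  the smaller class is all of \<open>V\<close>.
\<close>

section \<open>Additive categories\<close>

context category
begin

text \<open>Typing of arrows is decided by rewriting: hom-set memberships are unfolded to equations for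
  domain and codomain, and the laws of a category are stated with such equations as side
  conditions.\<close>

lemma Hom_iff:
  "f \<in> Hom T X Y \<longleftrightarrow> f \<in> Mor T \<and> Dom T f = X \<and> Cod T f = Y \<and> X \<in> Ob T \<and> Y \<in> Ob T"
  using dom_cod by (auto simp: Hom_def)

lemma Id_arr [simp]:
  assumes "X \<in> Ob T"
  shows "Id T X \<in> Mor T" "Dom T (Id T X) = X" "Cod T (Id T X) = X"
  using id_Hom[OF assms] by (auto simp: Hom_iff)

lemma comp_arr [simp]:
  assumes "f \<in> Mor T" "g \<in> Mor T" "Dom T g = Cod T f"
  shows "g \<cdot> f \<in> Mor T" "Dom T (g \<cdot> f) = Dom T f" "Cod T (g \<cdot> f) = Cod T g"
  using comp_Hom[of f "Dom T f" "Cod T f" g "Cod T g"] assms dom_cod by (auto simp: Hom_iff)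

lemma assoc [simp]:
  assumes "f \<in> Mor T" "g \<in> Mor T" "h \<in> Mor T" "Dom T g = Cod T f" "Dom T h = Cod T g"
  shows "(h \<cdot> g) \<cdot> f = h \<cdot> (g \<cdot> f)"
  using comp_assoc[of f "Dom T f" "Cod T f" g "Cod T g" h "Cod T h"] assms by (auto simp: Hom_def)

lemma comp_Id [simp]: "\<lbrakk>f \<in> Mor T; Dom T f = X\<rbrakk> \<Longrightarrow> f \<cdot> Id T X = f"
  using id_right[of f X "Cod T f"] by (auto simp: Hom_def)

lemma Id_comp [simp]: "\<lbrakk>f \<in> Mor T; Cod T f = X\<rbrakk> \<Longrightarrow> Id T X \<cdot> f = f"
  using id_left[of f "Dom T f" X] by (auto simp: Hom_def)

lemma iso_Id: "X \<in> Ob T \<Longrightarrow> iso T (Id T X)"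
  by (auto simp: iso_def Hom_iff intro!: bexI[of _ "Id T X"])

lemma coproduct_D:
  assumes "coproduct T J X C \<iota>"
  shows "C \<in> Ob T" "j \<in> J \<Longrightarrow> X j \<in> Ob T" "j \<in> J \<Longrightarrow> \<iota> j \<in> Hom T (X j) C"
  using assms by (auto simp: coproduct_def)

lemma coproduct_map:
  assumes "coproduct T J X C \<iota>" "Z \<in> Ob T" "\<And>j. j \<in> J \<Longrightarrow> h j \<in> Hom T (X j) Z"
  obtains f where "f \<in> Hom T C Z" "\<And>j. j \<in> J \<Longrightarrow> f \<cdot> \<iota> j = h j"
  using assms unfolding coproduct_def by blast

lemma coproduct_eq:
  assumes "coproduct T J X C \<iota>" "f \<in> Hom T C Z" "g \<in> Hom T C Z"
    "\<And>j. j \<in> J \<Longrightarrow> f \<cdot> \<iota> j = g \<cdot> \<iota> j"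
  shows "f = g"
proof -
  have Z: "Z \<in> Ob T" using assms(2) by (simp add: Hom_iff)
  have "\<forall>j\<in>J. g \<cdot> \<iota> j \<in> Hom T (X j) Z"
    using assms(1,3) comp_Hom by (fastforce simp: coproduct_def)
  then have "\<exists>!f. f \<in> Hom T C Z \<and> (\<forall>j\<in>J. f \<cdot> \<iota> j = g \<cdot> \<iota> j)"
    using assms(1) Z unfolding coproduct_def by simp
  then show ?thesis using assms(2-4) by blast
qed

lemma coproductI:
  assumes "C \<in> Ob T" "\<And>j. j \<in> J \<Longrightarrow> X j \<in> Ob T" "\<And>j. j \<in> J \<Longrightarrow> \<iota> j \<in> Hom T (X j) C"
    and ex: "\<And>Z h. \<lbrakk>Z \<in> Ob T; \<And>j. j \<in> J \<Longrightarrow> h j \<in> Hom T (X j) Z\<rbrakk> \<Longrightarrow>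
        \<exists>f \<in> Hom T C Z. \<forall>j\<in>J. f \<cdot> \<iota> j = h j"
    and un: "\<And>Z f g. \<lbrakk>f \<in> Hom T C Z; g \<in> Hom T C Z; \<And>j. j \<in> J \<Longrightarrow> f \<cdot> \<iota> j = g \<cdot> \<iota> j\<rbrakk> \<Longrightarrow> f = g"
  shows "coproduct T J X C \<iota>"
  unfolding coproduct_def
proof (intro conjI ballI allI impI)
  fix Z h assume Z: "Z \<in> Ob T" and h: "\<forall>j\<in>J. h j \<in> Hom T (X j) Z"
  have "\<exists>f \<in> Hom T C Z. \<forall>j\<in>J. f \<cdot> \<iota> j = h j" using ex[OF Z, of h] h by simp
  then obtain f where f: "f \<in> Hom T C Z" "\<forall>j\<in>J. f \<cdot> \<iota> j = h j" ..
  have "g = f" if "g \<in> Hom T C Z \<and> (\<forall>j\<in>J. g \<cdot> \<iota> j = h j)" for g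
    using un[of g Z f] that f by simp
  then show "\<exists>!f. f \<in> Hom T C Z \<and> (\<forall>j\<in>J. f \<cdot> \<iota> j = h j)"
    using f by blast
qed (use assms(1-3) in simp_all)

lemma coproduct_reindex:
  assumes "coproduct T (h ` J) X C \<iota>" "inj_on h J"
  shows "coproduct T J (X \<circ> h) C (\<iota> \<circ> h)"
proof (rule coproductI)
  fix Z g assume "Z \<in> Ob T" and g: "\<And>j. j \<in> J \<Longrightarrow> g j \<in> Hom T ((X \<circ> h) j) Z"
  then have "g (inv_into J h k) \<in> Hom T (X k) Z" if "k \<in> h ` J" for k
    using g[of "inv_into J h k"] that by (simp add: f_inv_into_f inv_into_into)
  then obtain f where f: "f \<in> Hom T C Z"
    "\<And>k. k \<in> h ` J \<Longrightarrow> f \<cdot> \<iota> k = g (inv_into J h k)"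
    using coproduct_map[OF assms(1) \<open>Z \<in> Ob T\<close>, of "\<lambda>k. g (inv_into J h k)"] by blast
  have "f \<cdot> (\<iota> \<circ> h) j = g j" if "j \<in> J" for j
    using f(2)[of "h j"] that assms(2) by simp
  with f(1) show "\<exists>f\<in>Hom T C Z. \<forall>j\<in>J. f \<cdot> (\<iota> \<circ> h) j = g j" by blast
next
  fix Z f g assume "f \<in> Hom T C Z" "g \<in> Hom T C Z"
    "\<And>j. j \<in> J \<Longrightarrow> f \<cdot> (\<iota> \<circ> h) j = g \<cdot> (\<iota> \<circ> h) j"
  then show "f = g" by (intro coproduct_eq[OF assms(1), of f Z g]) auto
qed (use assms(1) in \<open>auto simp: coproduct_def\<close>)

end


context additive_category
begin

lemma Zero_arr [simp]:
  assumes "X \<in> Ob T" "Y \<in> Ob T"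
  shows "Zero T X Y \<in> Mor T" "Dom T (Zero T X Y) = X" "Cod T (Zero T X Y) = Y"
  using zero_Hom[OF assms] by (auto simp: Hom_iff)

lemma plus_arr [simp]:
  assumes "f \<in> Mor T" "g \<in> Mor T" "Dom T g = Dom T f" "Cod T g = Cod T f"
  shows "f \<oplus> g \<in> Mor T" "Dom T (f \<oplus> g) = Dom T f" "Cod T (f \<oplus> g) = Cod T f"
  using plus_Hom[of f "Dom T f" "Cod T f" g] assms by (auto simp: Hom_def)

lemma Neg_arr [simp]:
  assumes "f \<in> Mor T"
  shows "Neg T f \<in> Mor T" "Dom T (Neg T f) = Dom T f" "Cod T (Neg T f) = Cod T f"
  using neg_Hom[of f "Dom T f" "Cod T f"] assms by (auto simp: Hom_def)

lemma distrib_left: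
  assumes "f \<in> Mor T" "g \<in> Mor T" "h \<in> Mor T" "Dom T g = Dom T f" "Cod T g = Cod T f"
    "Dom T h = Cod T f"
  shows "h \<cdot> (f \<oplus> g) = (h \<cdot> f) \<oplus> (h \<cdot> g)"
  using comp_plus_right[of f "Dom T f" "Cod T f" g h "Cod T h"] assms by (auto simp: Hom_def)

lemma distrib_right:
  assumes "f \<in> Mor T" "g \<in> Mor T" "h \<in> Mor T" "Dom T h = Dom T g" "Cod T h = Cod T g"
    "Dom T g = Cod T f"
  shows "(g \<oplus> h) \<cdot> f = (g \<cdot> f) \<oplus> (h \<cdot> f)"
  using comp_plus_left[of f "Dom T f" "Cod T f" g "Cod T g" h] assms by (auto simp: Hom_def)

lemma plus_Zero [simp]: "f \<in> Hom T X Y \<Longrightarrow> f \<oplus> Zero T X Y = f"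
  by (rule plus_zero)

lemma Zero_plus [simp]: "f \<in> Hom T X Y \<Longrightarrow> Zero T X Y \<oplus> f = f"
  using plus_commute[of "Zero T X Y" X Y f] plus_zero[of f X Y] by (simp add: Hom_iff)

text \<open>Each hom-set is an abelian group, but not the carrier of a type-class group; the
  cancellation laws needed below are therefore stated explicitly.\<close>

lemma eq_iff_minus:
  assumes "f \<in> Hom T X Y" "g \<in> Hom T X Y"
  shows "f \<oplus> Neg T g = Zero T X Y \<longleftrightarrow> f = g"
proof
  assume eq: "f \<oplus> Neg T g = Zero T X Y"
  have "f = f \<oplus> (Neg T g \<oplus> g)"
    using plus_commute[of "Neg T g" X Y g] plus_neg[of g X Y] plus_zero[of f X Y] neg_Hom assms
    by simp
  also have "\<dots> = (f \<oplus> Neg T g) \<oplus> g"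
    using plus_assoc[of f X Y "Neg T g" g] neg_Hom assms by simp
  finally show "f = g" using eq assms by simp
qed (use assms plus_neg in auto)

lemma minus_minus:
  assumes "f \<in> Hom T X Y" "g \<in> Hom T X Y" "f \<oplus> Neg T g = h"
  shows "f \<oplus> Neg T h = g"
proof -
  have N: "Neg T g \<in> Hom T X Y" and h: "h \<in> Hom T X Y"
    using neg_Hom plus_Hom assms by blast+
  have "f = f \<oplus> (Neg T g \<oplus> g)"
    using plus_commute[OF N assms(2)] plus_neg[OF assms(2)] plus_zero[OF assms(1)] by simp
  also have "\<dots> = h \<oplus> g" using plus_assoc[OF assms(1) N assms(2)] assms(3) by simp
  also have "\<dots> = g \<oplus> h" using plus_commute h assms by blast
  finally have "f \<oplus> Neg T h = g \<oplus> (h \<oplus> Neg T h)"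
    using plus_assoc[OF assms(2) h neg_Hom[OF h]] by simp
  then show ?thesis using plus_neg[OF h] plus_zero assms(2) by simp
qed

lemma plus_right_cancel:
  assumes "f \<in> Hom T X Y" "g \<in> Hom T X Y" "h \<in> Hom T X Y" "f \<oplus> h = g \<oplus> h"
  shows "f = g"
  using assms plus_assoc[OF _ assms(3) neg_Hom[OF assms(3)]] plus_neg[OF assms(3)] plus_zero
  by metis

lemma idem_Zero:
  assumes "f \<in> Hom T X Y" "f \<oplus> f = f"
  shows "f = Zero T X Y"
  using plus_right_cancel[of f X Y "Zero T X Y" f] assms by (simp add: Hom_iff)

lemma comp_Zero [simp]:
  assumes "f \<in> Mor T" "X \<in> Ob T" "Dom T f = Y"
  shows "f \<cdot> Zero T X Y = Zero T X (Cod T f)"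
proof -
  have Y: "Y \<in> Ob T" "Cod T f \<in> Ob T" using assms dom_cod by auto
  have "Zero T X Y \<oplus> Zero T X Y = Zero T X Y" using assms Y by (simp add: zero_Hom)
  then have "f \<cdot> Zero T X Y \<oplus> f \<cdot> Zero T X Y = f \<cdot> Zero T X Y"
    using distrib_left[of "Zero T X Y" "Zero T X Y" f] assms Y by simp
  then show ?thesis using assms Y by (intro idem_Zero) (simp_all add: Hom_iff)
qed

lemma Zero_comp [simp]:
  assumes "f \<in> Mor T" "Z \<in> Ob T" "Cod T f = Y"
  shows "Zero T Y Z \<cdot> f = Zero T (Dom T f) Z"
proof -
  have Y: "Y \<in> Ob T" "Dom T f \<in> Ob T" using assms dom_cod by auto
  have "Zero T Y Z \<oplus> Zero T Y Z = Zero T Y Z" using assms Y by (simp add: zero_Hom)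
  then have "Zero T Y Z \<cdot> f \<oplus> Zero T Y Z \<cdot> f = Zero T Y Z \<cdot> f"
    using distrib_right[of f "Zero T Y Z" "Zero T Y Z"] assms Y by simp
  then show ?thesis using assms Y by (intro idem_Zero) (simp_all add: Hom_iff)
qed

lemma Neg_unique:
  assumes "f \<in> Hom T X Y" "g \<in> Hom T X Y" "f \<oplus> g = Zero T X Y"
  shows "g = Neg T f"
proof -
  have N: "Neg T f \<in> Hom T X Y" using neg_Hom assms by blast
  have "g \<oplus> f = Neg T f \<oplus> f"
    using plus_commute[OF assms(1,2)] plus_commute[OF assms(1) N] plus_neg[OF assms(1)] assms(3)
    by simp
  then show ?thesis using plus_right_cancel assms N by blast
qed

lemma Neg_Neg [simp]:
  assumes "f \<in> Mor T"
  shows "Neg T (Neg T f) = f"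
proof -
  have f: "f \<in> Hom T (Dom T f) (Cod T f)" using assms by (simp add: Hom_def)
  show ?thesis
    using Neg_unique[OF neg_Hom[OF f] f] plus_commute[OF f neg_Hom[OF f]] plus_neg[OF f] by simp
qed

lemma Neg_Zero [simp]: "\<lbrakk>X \<in> Ob T; Y \<in> Ob T\<rbrakk> \<Longrightarrow> Neg T (Zero T X Y) = Zero T X Y"
  using Neg_unique[of "Zero T X Y" X Y "Zero T X Y"] by (simp add: zero_Hom)

lemma comp_Neg [simp]:
  assumes "f \<in> Mor T" "h \<in> Mor T" "Dom T h = Cod T f"
  shows "h \<cdot> Neg T f = Neg T (h \<cdot> f)"
proof (rule Neg_unique)
  have f: "f \<in> Hom T (Dom T f) (Cod T f)" using assms by (simp add: Hom_def)
  show "h \<cdot> f \<oplus> h \<cdot> Neg T f = Zero T (Dom T f) (Cod T h)"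
    using distrib_left[of f "Neg T f" h] plus_neg[OF f] assms dom_cod by simp
qed (use assms in \<open>auto simp: Hom_def\<close>)

lemma Neg_comp [simp]:
  assumes "f \<in> Mor T" "h \<in> Mor T" "Dom T h = Cod T f"
  shows "Neg T h \<cdot> f = Neg T (h \<cdot> f)"
proof (rule Neg_unique)
  have h: "h \<in> Hom T (Dom T h) (Cod T h)" using assms by (simp add: Hom_def)
  show "h \<cdot> f \<oplus> Neg T h \<cdot> f = Zero T (Dom T f) (Cod T h)"
    using distrib_right[of f h "Neg T h"] plus_neg[OF h] assms dom_cod by simp
qed (use assms in \<open>auto simp: Hom_def\<close>)

text \<open>Orthogonality of two objects: every map between them vanishes.\<close>

definition orth :: "'a \<Rightarrow> 'a \<Rightarrow> bool" where
  "orth P Q \<longleftrightarrow> (\<forall>f \<in> Hom T P Q. f = Zero T P Q)"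

lemma Hom_eq_Zero_iff: "\<lbrakk>P \<in> Ob T; Q \<in> Ob T\<rbrakk> \<Longrightarrow> Hom T P Q = {Zero T P Q} \<longleftrightarrow> orth P Q"
  unfolding orth_def using zero_Hom by blast

lemma orthD: "\<lbrakk>orth P Q; f \<in> Hom T P Q\<rbrakk> \<Longrightarrow> f = Zero T P Q"
  unfolding orth_def by blast

lemma orthI: "(\<And>f. f \<in> Hom T P Q \<Longrightarrow> f = Zero T P Q) \<Longrightarrow> orth P Q"
  unfolding orth_def by blast

lemma orth_retract_right:
  assumes "orth P A" "u \<in> Hom T A X" "t \<in> Hom T X A" "u \<cdot> t = Id T X"
  shows "orth P X"
proof (rule orthI)
  fix f assume f: "f \<in> Hom T P X"
  have "t \<cdot> f = Zero T P A" using assms(1,3) f by (intro orthD comp_Hom)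
  then have "u \<cdot> (t \<cdot> f) = Zero T P X" using assms(2) f by (simp add: Hom_iff)
  moreover have "u \<cdot> (t \<cdot> f) = (u \<cdot> t) \<cdot> f" using assms(2,3) f by (simp add: Hom_iff)
  ultimately show "f = Zero T P X" using assms(4) f by (simp add: Hom_iff)
qed

lemma orth_retract_left:
  assumes "orth A Q" "u \<in> Hom T A X" "t \<in> Hom T X A" "u \<cdot> t = Id T X"
  shows "orth X Q"
proof (rule orthI)
  fix f assume f: "f \<in> Hom T X Q"
  have "f \<cdot> u = Zero T A Q" using assms(1,2) f by (intro orthD) (auto intro: comp_Hom)
  then have "(f \<cdot> u) \<cdot> t = Zero T X Q" using assms(3) f by (simp add: Hom_iff)
  then show "f = Zero T X Q" using assms f by (simp add: Hom_iff)
qed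

lemma orth_coproduct:
  assumes "coproduct T J X C \<iota>" "\<And>j. j \<in> J \<Longrightarrow> orth (X j) Q"
  shows "orth C Q"
proof (rule orthI)
  fix f assume f: "f \<in> Hom T C Q"
  show "f = Zero T C Q"
  proof (rule coproduct_eq[OF assms(1) f])
    fix j assume j: "j \<in> J"
    have "\<iota> j \<in> Hom T (X j) C" using coproduct_D[OF assms(1)] j by blast
    then show "f \<cdot> \<iota> j = Zero T C Q \<cdot> \<iota> j"
      using orthD[OF assms(2)[OF j] comp_Hom[OF _ f]] f by (simp add: Hom_iff)
  qed (use f in \<open>simp add: Hom_iff\<close>)
qed

lemma orth_direct_sum_left:
  assumes "direct_sum T A B S"
  shows "orth S Q \<longleftrightarrow> orth A Q \<and> orth B Q"
proof -
  from assms obtain i j p q where m: "i \<in> Hom T A S" "j \<in> Hom T B S" "p \<in> Hom T S A" "q \<in> Hom T S B"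
    "p \<cdot> i = Id T A" "q \<cdot> j = Id T B" "i \<cdot> p \<oplus> j \<cdot> q = Id T S"
    unfolding direct_sum_def by blast
  show ?thesis
  proof (intro iffI conjI)
    assume "orth S Q"
    then show "orth A Q" "orth B Q" using orth_retract_left m by blast+
  next
    assume o: "orth A Q \<and> orth B Q"
    show "orth S Q"
    proof (rule orthI)
      fix f assume f: "f \<in> Hom T S Q"
      have "f \<cdot> i = Zero T A Q" "f \<cdot> j = Zero T B Q"
        using o orthD comp_Hom m f by blast+
      moreover have "f = f \<cdot> (i \<cdot> p \<oplus> j \<cdot> q)" using m(7) f by (simp add: Hom_iff)
      then have "f = (f \<cdot> i) \<cdot> p \<oplus> (f \<cdot> j) \<cdot> q"
        using m f distrib_left[of "i \<cdot> p" "j \<cdot> q" f] by (simp add: Hom_iff)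
      ultimately show "f = Zero T S Q" using m f by (simp add: Hom_iff zero_Hom)
    qed
  qed
qed

lemma orth_direct_sum_right:
  assumes "direct_sum T A B S"
  shows "orth P S \<longleftrightarrow> orth P A \<and> orth P B"
proof -
  from assms obtain i j p q where m: "i \<in> Hom T A S" "j \<in> Hom T B S" "p \<in> Hom T S A" "q \<in> Hom T S B"
    "p \<cdot> i = Id T A" "q \<cdot> j = Id T B" "i \<cdot> p \<oplus> j \<cdot> q = Id T S"
    unfolding direct_sum_def by blast
  show ?thesis
  proof (intro iffI conjI)
    assume "orth P S"
    then show "orth P A" "orth P B" using orth_retract_right m by blast+
  next
    assume o: "orth P A \<and> orth P B"
    show "orth P S"
    proof (rule orthI)
      fix f assume f: "f \<in> Hom T P S"
      have "p \<cdot> f = Zero T P A" "q \<cdot> f = Zero T P B"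
        using o orthD comp_Hom m f by blast+
      moreover have "f = (i \<cdot> p \<oplus> j \<cdot> q) \<cdot> f" using m(7) f by (simp add: Hom_iff)
      then have "f = i \<cdot> (p \<cdot> f) \<oplus> j \<cdot> (q \<cdot> f)"
        using m f distrib_right[of f "i \<cdot> p" "j \<cdot> q"] by (simp add: Hom_iff)
      ultimately show "f = Zero T P S" using m f by (simp add: Hom_iff zero_Hom)
    qed
  qed
qed

lemma zero_objectI:
  assumes "Z \<in> Ob T" "orth Z Z"
  shows "zero_object T Z"
proof -
  have id0: "Id T Z = Zero T Z Z" using assms id_Hom orthD by blast
  have "f = Zero T X Z" if f: "f \<in> Hom T X Z" for X f
    using id_left[OF f] id0 f by (simp add: Hom_iff)
  moreover have "f = Zero T Z X" if f: "f \<in> Hom T Z X" for X f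
    using id_right[OF f] id0 f by (simp add: Hom_iff)
  ultimately show ?thesis using assms(1) zero_Hom unfolding zero_object_def by blast
qed

lemma zero_object_orth:
  assumes "zero_object T Z" "P \<in> Ob T"
  shows "orth Z P" "orth P Z"
  using assms zero_Hom unfolding zero_object_def orth_def by blast+

end


section \<open>Exactness in triangulated categories\<close>

context triangulated_category
begin

lemma shM_arr [simp]:
  assumes "f \<in> Mor T"
  shows "ShM T f \<in> Mor T" "Dom T (ShM T f) = Sh T (Dom T f)" "Cod T (ShM T f) = Sh T (Cod T f)"
  using shM_Hom[of f "Dom T f" "Cod T f"] assms by (auto simp: Hom_def)

lemma Sh_Ob [simp]: "X \<in> Ob T \<Longrightarrow> Sh T X \<in> Ob T"
  using sh_bij by (auto simp: bij_betw_def)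

lemma Sh_inj: "\<lbrakk>X \<in> Ob T; Y \<in> Ob T; Sh T X = Sh T Y\<rbrakk> \<Longrightarrow> X = Y"
  using sh_bij by (auto simp: bij_betw_def inj_on_def)

lemma Sh_surj:
  assumes "Y \<in> Ob T" obtains X where "X \<in> Ob T" "Sh T X = Y"
proof -
  have "Y \<in> Sh T ` Ob T" using sh_bij assms by (simp add: bij_betw_def)
  then show thesis using that by blast
qed

lemma shM_inj: "\<lbrakk>f \<in> Mor T; g \<in> Mor T; ShM T f = ShM T g\<rbrakk> \<Longrightarrow> f = g"
  using shM_bij by (auto simp: bij_betw_def inj_on_def)

lemma shM_surj:
  assumes "g \<in> Hom T (Sh T X) (Sh T Y)" "X \<in> Ob T" "Y \<in> Ob T"
  obtains f where "f \<in> Hom T X Y" "ShM T f = g"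
proof -
  have "g \<in> ShM T ` Mor T" using shM_bij assms(1) by (simp add: bij_betw_def Hom_def)
  then obtain f where f: "f \<in> Mor T" "ShM T f = g" by blast
  have "Sh T (Dom T f) = Sh T X" "Sh T (Cod T f) = Sh T Y"
    using f assms(1) by (auto simp: Hom_def)
  then have "Dom T f = X" "Cod T f = Y" using Sh_inj dom_cod f assms by blast+
  then show thesis using that f by (auto simp: Hom_def)
qed

lemma shM_comp_arr:
  assumes "f \<in> Mor T" "g \<in> Mor T" "Dom T g = Cod T f"
  shows "ShM T (g \<cdot> f) = ShM T g \<cdot> ShM T f"
  using shM_comp[of f "Dom T f" "Cod T f" g "Cod T g"] assms by (auto simp: Hom_def)

lemma shM_plus_arr:
  assumes "f \<in> Mor T" "g \<in> Mor T" "Dom T g = Dom T f" "Cod T g = Cod T f"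
  shows "ShM T (f \<oplus> g) = ShM T f \<oplus> ShM T g"
  using shM_plus[of f "Dom T f" "Cod T f" g] assms by (auto simp: Hom_def)

lemma shM_Zero [simp]:
  assumes "X \<in> Ob T" "Y \<in> Ob T"
  shows "ShM T (Zero T X Y) = Zero T (Sh T X) (Sh T Y)"
proof (rule idem_Zero)
  show "ShM T (Zero T X Y) \<in> Hom T (Sh T X) (Sh T Y)" using assms by (simp add: Hom_iff)
  show "ShM T (Zero T X Y) \<oplus> ShM T (Zero T X Y) = ShM T (Zero T X Y)"
    using shM_plus[of "Zero T X Y" X Y "Zero T X Y"] assms by (simp add: zero_Hom)
qed

lemma shM_Neg [simp]:
  assumes "f \<in> Mor T"
  shows "ShM T (Neg T f) = Neg T (ShM T f)"
proof (rule Neg_unique)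
  have "f \<oplus> Neg T f = Zero T (Dom T f) (Cod T f)"
    using assms by (intro plus_neg) (simp add: Hom_def)
  then show "ShM T f \<oplus> ShM T (Neg T f) = Zero T (Sh T (Dom T f)) (Sh T (Cod T f))"
    using shM_plus_arr[of f "Neg T f"] assms dom_cod by simp
qed (use assms in \<open>auto simp: Hom_def\<close>)

lemma orth_Sh_iff:
  assumes "P \<in> Ob T" "Q \<in> Ob T"
  shows "orth (Sh T P) (Sh T Q) \<longleftrightarrow> orth P Q"
proof
  assume o: "orth (Sh T P) (Sh T Q)"
  show "orth P Q"
  proof (rule orthI)
    fix f assume f: "f \<in> Hom T P Q"
    have "ShM T f = ShM T (Zero T P Q)" using orthD[OF o shM_Hom[OF f]] assms by simp
    then show "f = Zero T P Q" by (rule shM_inj[rotated 2]) (use f assms in \<open>simp_all add: Hom_iff\<close>)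
  qed
next
  assume o: "orth P Q"
  show "orth (Sh T P) (Sh T Q)"
  proof (rule orthI)
    fix g assume "g \<in> Hom T (Sh T P) (Sh T Q)"
    then obtain f where f: "f \<in> Hom T P Q" "ShM T f = g" by (rule shM_surj[OF _ assms])
    then show "g = Zero T (Sh T P) (Sh T Q)" using orthD[OF o f(1)] assms by simp
  qed
qed

text \<open>A distinguished triangle \<open>X \<rightarrow> Y \<rightarrow> Z \<rightarrow> X[1]\<close> together with the objects it lives on.\<close>

definition triangle :: "'a \<Rightarrow> 'a \<Rightarrow> 'a \<Rightarrow> 'b \<Rightarrow> 'b \<Rightarrow> 'b \<Rightarrow> bool" where
  "triangle X Y Z u v w \<longleftrightarrow>
     u \<in> Hom T X Y \<and> v \<in> Hom T Y Z \<and> w \<in> Hom T Z (Sh T X) \<and> (u, v, w) \<in> Tri T"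

lemma triangle_exists:
  assumes "u \<in> Hom T X Y"
  obtains Z v w where "triangle X Y Z u v w"
proof -
  obtain v w where t: "(u, v, w) \<in> Tri T" using TR1_cone[of u] assms by (force simp: Hom_def)
  from tri_typed[OF t] assms show thesis using t that unfolding triangle_def Hom_def by auto
qed

lemma triangle_rotate:
  "triangle X Y Z u v w \<Longrightarrow> triangle Y Z (Sh T X) v w (Neg T (ShM T u))"
  unfolding triangle_def using TR2 neg_Hom shM_Hom by blast

text \<open>The converse rotation needs a preimage of the last map under the shift, which exists because
  the shift is bijective on arrows.\<close>

lemma triangle_rotate_back:
  assumes "triangle Y Z (Sh T X) v w u'" "X \<in> Ob T"
  obtains u where "triangle X Y Z u v w" "u' = Neg T (ShM T u)"
proof -
  have t: "(v, w, u') \<in> Tri T" "v \<in> Hom T Y Z" "w \<in> Hom T Z (Sh T X)" "u' \<in> Hom T (Sh T X) (Sh T Y)"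
    using assms(1) by (auto simp: triangle_def)
  then obtain u where u: "u \<in> Hom T X Y" "ShM T u = Neg T u'"
    using shM_surj[of "Neg T u'" X Y] neg_Hom assms(2) by (auto simp: Hom_iff)
  then have u': "u' = Neg T (ShM T u)" using t(4) by (simp add: Hom_iff)
  then have "(u, v, w) \<in> Tri T" using TR2[OF u(1) t(2,3)] t(1) by simp
  then show thesis using that u u' t unfolding triangle_def by blast
qed

lemma triangle_Id:
  assumes "X \<in> Ob T" "zero_object T Z"
  shows "triangle X X Z (Id T X) (Zero T X Z) (Zero T Z (Sh T X))"
  using TR1_id[OF assms] assms by (simp add: triangle_def Hom_iff zero_object_def)

lemma triangle_morphism:
  assumes "triangle X Y Z u v w" "triangle X' Y' Z' u' v' w'"
    "a \<in> Hom T X X'" "b \<in> Hom T Y Y'" "b \<cdot> u = u' \<cdot> a"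
  obtains c where "c \<in> Hom T Z Z'" "c \<cdot> v = v' \<cdot> b" "ShM T a \<cdot> w = w' \<cdot> c"
  using TR3[of u v w u' v' w' X Y Z X' Y' Z' a b] assms unfolding triangle_def by blast

lemma triangle_comp_Zero:
  assumes "triangle X Y Z u v w"
  shows "v \<cdot> u = Zero T X Z"
proof -
  obtain N where N: "zero_object T N" using ex_zero_object by blast
  have X: "X \<in> Ob T" and u: "u \<in> Hom T X Y" using assms by (auto simp: triangle_def Hom_iff)
  obtain c where "c \<in> Hom T N Z" "c \<cdot> Zero T X N = v \<cdot> u"
    using triangle_morphism[OF triangle_Id[OF X N] assms id_Hom[OF X] u] by auto
  then show ?thesis using X by (simp add: Hom_iff)
qed

text \<open>Exactness of \<open>Hom(P, -)\<close> and of \<open>Hom(-, Q)\<close> at the middle term of a triangle.\<close>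

lemma weak_kernel:
  assumes t: "triangle X Y Z u v w" and g: "g \<in> Hom T P Y" "v \<cdot> g = Zero T P Z"
  obtains g' where "g' \<in> Hom T P X" "g = u \<cdot> g'"
proof -
  obtain N where N: "zero_object T N" using ex_zero_object by blast
  have m: "P \<in> Ob T" "X \<in> Ob T" "Y \<in> Ob T" "Z \<in> Ob T" "N \<in> Ob T"
    and u: "u \<in> Hom T X Y" "v \<in> Hom T Y Z" "w \<in> Hom T Z (Sh T X)"
    using t g N by (auto simp: triangle_def Hom_iff zero_object_def)
  have "Zero T N Z \<cdot> Zero T P N = v \<cdot> g" using m g by simp
  then obtain c where c: "c \<in> Hom T (Sh T P) (Sh T X)"
    "ShM T g \<cdot> Neg T (ShM T (Id T P)) = Neg T (ShM T u) \<cdot> c"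
    using triangle_morphism[OF triangle_rotate[OF triangle_Id[OF m(1) N]] triangle_rotate[OF t] g(1)
        zero_Hom[OF m(5,4)]] by auto
  obtain g' where g': "g' \<in> Hom T P X" "ShM T g' = c" using shM_surj[OF c(1)] m by blast
  have "Neg T (ShM T g) = Neg T (ShM T u \<cdot> c)"
    using c g u m by (simp add: Hom_iff shM_id)
  then have "Neg T (Neg T (ShM T g)) = Neg T (Neg T (ShM T u \<cdot> c))" by simp
  then have "ShM T g = ShM T u \<cdot> c" using c u g by (simp add: Hom_iff)
  then have "ShM T g = ShM T (u \<cdot> g')" using g' u by (simp add: Hom_iff shM_comp_arr)
  then have "g = u \<cdot> g'" by (rule shM_inj[rotated 2]) (use g g' u in \<open>simp_all add: Hom_iff\<close>)
  then show thesis using that g' by blast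
qed

lemma weak_cokernel:
  assumes t: "triangle X Y Z u v w" and f: "f \<in> Hom T Y Q" "f \<cdot> u = Zero T X Q"
  obtains f' where "f' \<in> Hom T Z Q" "f = f' \<cdot> v"
proof -
  obtain N where N: "zero_object T N" using ex_zero_object by blast
  then obtain N' where N': "N' \<in> Ob T" "Sh T N' = N" using Sh_surj by (auto simp: zero_object_def)
  have m: "Q \<in> Ob T" "X \<in> Ob T" "Y \<in> Ob T" "Z \<in> Ob T" "N \<in> Ob T"
    and u: "u \<in> Hom T X Y" "v \<in> Hom T Y Z" "w \<in> Hom T Z (Sh T X)"
    using t f N by (auto simp: triangle_def Hom_iff zero_object_def)
  have "triangle Q Q (Sh T N') (Id T Q) (Zero T Q N) (Zero T N (Sh T Q))"
    using triangle_Id[OF m(1) N] N' by simp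
  then obtain z where z: "triangle N' Q Q z (Id T Q) (Zero T Q N)"
    "Zero T N (Sh T Q) = Neg T (ShM T z)"
    using triangle_rotate_back N'(1) by blast
  then have zH: "z \<in> Hom T N' Q" by (simp add: triangle_def)
  have "f \<cdot> u = z \<cdot> Zero T X N'" using f m N' zH by (simp add: Hom_iff)
  then obtain c where c: "c \<in> Hom T Z Q" "c \<cdot> v = Id T Q \<cdot> f"
    using triangle_morphism[OF t z(1) zero_Hom[OF m(2) N'(1)] f(1)] by blast
  then have "f = c \<cdot> v" using f by (simp add: Hom_iff)
  then show thesis using that c by blast
qed

lemma orth_middle_right:
  assumes t: "triangle X Y Z u v w" and "orth P X" "orth P Z"
  shows "orth P Y"
proof (rule orthI)
  fix f assume f: "f \<in> Hom T P Y"
  have u: "u \<in> Hom T X Y" "v \<in> Hom T Y Z" using t by (auto simp: triangle_def)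
  have "v \<cdot> f = Zero T P Z" using assms(3) u f by (intro orthD comp_Hom)
  then obtain g where g: "g \<in> Hom T P X" "f = u \<cdot> g" using weak_kernel[OF t f] by blast
  then show "f = Zero T P Y" using orthD[OF assms(2) g(1)] u by (simp add: Hom_iff)
qed

lemma orth_middle_left:
  assumes t: "triangle X Y Z u v w" and "orth X Q" "orth Z Q"
  shows "orth Y Q"
proof (rule orthI)
  fix f assume f: "f \<in> Hom T Y Q"
  have u: "u \<in> Hom T X Y" "v \<in> Hom T Y Z" using t by (auto simp: triangle_def)
  have "f \<cdot> u = Zero T X Q" using assms(2) by (rule orthD) (rule comp_Hom[OF u(1) f])
  then obtain g where g: "g \<in> Hom T Z Q" "f = g \<cdot> v" using weak_cokernel[OF t f] by blast
  then show "f = Zero T Y Q" using orthD[OF assms(3) g(1)] u by (simp add: Hom_iff)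
qed

lemma weak_kernel_shift:
  assumes t: "triangle X Y Z u v w" and g: "g \<in> Hom T P (Sh T X)" "ShM T u \<cdot> g = Zero T P (Sh T Y)"
  obtains g' where "g' \<in> Hom T P Z" "g = w \<cdot> g'"
proof -
  have "u \<in> Hom T X Y" using t by (simp add: triangle_def)
  then have "Neg T (ShM T u) \<cdot> g = Zero T P (Sh T Y)" using g by (simp add: Hom_iff)
  then show thesis using weak_kernel[OF triangle_rotate[OF triangle_rotate[OF t]] g(1)] that by blast
qed

lemma weak_cokernel_shift:
  assumes t: "triangle X Y Z u v w" and f: "f \<in> Hom T (Sh T X) Q" "f \<cdot> w = Zero T Z Q"
  obtains f' where "f' \<in> Hom T (Sh T Y) Q" "f = f' \<cdot> ShM T u"
proof -
  obtain f' where f': "f' \<in> Hom T (Sh T Y) Q" "f = f' \<cdot> Neg T (ShM T u)"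
    using weak_cokernel[OF triangle_rotate[OF triangle_rotate[OF t]] f] by blast
  have u: "u \<in> Hom T X Y" using t by (simp add: triangle_def)
  have "f = Neg T f' \<cdot> ShM T u" using f' u by (simp add: Hom_iff)
  then show thesis using that[OF neg_Hom[OF f'(1)]] by blast
qed

lemma triangle_vanishing:
  assumes t: "triangle X Y Z u v w"
  shows "v \<cdot> u = Zero T X Z" "w \<cdot> v = Zero T Y (Sh T X)" "ShM T u \<cdot> w = Zero T Z (Sh T Y)"
proof -
  show "v \<cdot> u = Zero T X Z" using triangle_comp_Zero[OF t] .
  show "w \<cdot> v = Zero T Y (Sh T X)" using triangle_comp_Zero[OF triangle_rotate[OF t]] .
  have m: "u \<in> Hom T X Y" "w \<in> Hom T Z (Sh T X)" using t by (auto simp: triangle_def)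
  have "Neg T (ShM T u \<cdot> w) = Zero T Z (Sh T Y)"
    using triangle_comp_Zero[OF triangle_rotate[OF triangle_rotate[OF t]]] m by (simp add: Hom_iff)
  then have "Neg T (Neg T (ShM T u \<cdot> w)) = Neg T (Zero T Z (Sh T Y))" by simp
  then show "ShM T u \<cdot> w = Zero T Z (Sh T Y)" using m by (simp add: Hom_iff)
qed

text \<open>\<open>cone_of f C\<close>: the map \<open>f\<close> has \<open>C\<close> as a cone.\<close>

definition cone_of :: "'b \<Rightarrow> 'a \<Rightarrow> bool" where
  "cone_of f C \<longleftrightarrow> (\<exists>X Y v w. triangle X Y C f v w)"

lemma cone_ofD:
  assumes "cone_of f C" "f \<in> Hom T X Y"
  obtains v w where "triangle X Y C f v w"
proof -
  obtain X' Y' v w where t: "triangle X' Y' C f v w" using assms(1) unfolding cone_of_def by blast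
  then have "X' = X" "Y' = Y" using assms(2) by (auto simp: triangle_def Hom_def)
  then show thesis using that t by blast
qed

lemma cone_of_exists:
  assumes "f \<in> Hom T X Y" obtains C where "cone_of f C"
proof -
  obtain Z v w where "triangle X Y Z f v w" using triangle_exists[OF assms] .
  then show thesis using that unfolding cone_of_def by blast
qed

lemma cone_of_Ob: "cone_of f C \<Longrightarrow> C \<in> Ob T"
  by (auto simp: cone_of_def triangle_def Hom_iff)

lemma cone_of_iso:
  assumes "cone_of f C" "c \<in> Hom T C C'" "iso T c"
  shows "cone_of f C'"
proof -
  obtain X Y v w where t: "triangle X Y C f v w" using assms(1) by (auto simp: cone_of_def)
  then have m: "f \<in> Hom T X Y" "v \<in> Hom T Y C" "w \<in> Hom T C (Sh T X)" "X \<in> Ob T" "Y \<in> Ob T"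
    "(f, v, w) \<in> Tri T"
    by (auto simp: triangle_def Hom_iff)
  from assms obtain d where d: "d \<in> Hom T C' C" "d \<cdot> c = Id T C"
    by (auto simp: iso_def Hom_iff)
  have "(f, c \<cdot> v, w \<cdot> d) \<in> Tri T"
  proof (rule TR1_iso[OF m(6,1,2,3,1) _ _ id_Hom id_Hom assms(2) iso_Id iso_Id assms(3)])
    show "c \<cdot> v \<in> Hom T Y C'" "w \<cdot> d \<in> Hom T C' (Sh T X)"
      using m d assms(2) comp_Hom by blast+
    show "ShM T (Id T X) \<cdot> w = (w \<cdot> d) \<cdot> c" using m d assms(2) by (simp add: Hom_iff shM_id)
  qed (use m assms(2) in \<open>simp_all add: Hom_iff\<close>)
  then show ?thesis using m d assms(2) comp_Hom unfolding cone_of_def triangle_def by blast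
qed

text \<open>The octahedral axiom, reduced to the one triangle that it produces between the cones of two
  composable maps and of their composite.\<close>

lemma octahedron:
  assumes "f \<in> Hom T X Y" "g \<in> Hom T Y Z" "cone_of f A" "cone_of g B" "cone_of (g \<cdot> f) E"
  obtains a b c where "triangle A E B a b c"
proof -
  obtain v w where t1: "triangle X Y A f v w" using cone_ofD[OF assms(3,1)] .
  obtain v' w' where t2: "triangle Y Z B g v' w'" using cone_ofD[OF assms(4,2)] .
  obtain m n where t3: "triangle X Z E (g \<cdot> f) m n"
    using cone_ofD[OF assms(5) comp_Hom[OF assms(1,2)]] .
  note tri = t1[unfolded triangle_def] t2[unfolded triangle_def] t3[unfolded triangle_def]
  have "\<exists>a\<in>Hom T A E. \<exists>b\<in>Hom T E B. (a, b, ShM T v \<cdot> w') \<in> Tri T \<and>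
      n \<cdot> a = w \<and> b \<cdot> m = v' \<and> a \<cdot> v = m \<cdot> g \<and> w' \<cdot> b = ShM T f \<cdot> n"
    by (rule TR4[of f v w g v' w' m n X Y A Z B E]) (use tri in simp_all)
  then obtain a b where "a \<in> Hom T A E" "b \<in> Hom T E B" "(a, b, ShM T v \<cdot> w') \<in> Tri T"
    by blast
  moreover have "ShM T v \<cdot> w' \<in> Hom T B (Sh T A)"
    using tri by (simp add: Hom_iff)
  ultimately show thesis using that unfolding triangle_def by blast
qed

lemma cone_of_Id:
  assumes "X \<in> Ob T" obtains Z where "cone_of (Id T X) Z" "zero_object T Z"
proof -
  obtain Z where Z: "zero_object T Z" using ex_zero_object by blast
  then have "cone_of (Id T X) Z" using triangle_Id[OF assms Z] unfolding cone_of_def by blast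
  then show thesis using that Z by blast
qed

end


section \<open>Iterated shifts and orthogonal subcategories\<close>

context triangulated_category
begin

lemma funpow_inv_Sh:
  assumes "X \<in> Ob T"
  shows "(inv_into (Ob T) (Sh T) ^^ k) X \<in> Ob T"
proof (induction k)
  case (Suc k)
  have "(inv_into (Ob T) (Sh T) ^^ k) X \<in> Sh T ` Ob T"
    using Suc sh_bij by (simp add: bij_betw_def)
  then show ?case by (simp add: inv_into_into)
qed (use assms in simp)

lemma shift_Ob [simp]:
  assumes "X \<in> Ob T" shows "shift T n X \<in> Ob T"
proof -
  have "(Sh T ^^ k) X \<in> Ob T" for k by (induction k) (use assms in auto)
  then show ?thesis using funpow_inv_Sh assms by (simp add: shift_def)
qed

lemma shift_0 [simp]: "shift T 0 X = X"
  by (simp add: shift_def)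

lemma Sh_shift:
  assumes "X \<in> Ob T" shows "Sh T (shift T n X) = shift T (n + 1) X"
proof (cases "0 \<le> n")
  case True
  then have "nat (n + 1) = Suc (nat n)" by simp
  then show ?thesis using True by (simp add: shift_def)
next
  case False
  define k where "k = nat (- n - 1)"
  have k: "nat (- n) = Suc k" "nat (- (n + 1)) = k" using False by (auto simp: k_def)
  have "(inv_into (Ob T) (Sh T) ^^ k) X \<in> Sh T ` Ob T"
    using funpow_inv_Sh[OF assms] sh_bij by (simp add: bij_betw_def)
  then have "Sh T (shift T n X) = (inv_into (Ob T) (Sh T) ^^ k) X"
    using False k by (simp add: shift_def f_inv_into_f)
  also have "\<dots> = shift T (n + 1) X"
    using False k by (cases "n = -1") (auto simp: shift_def)
  finally show ?thesis .
qed

lemma shift_1 [simp]: "X \<in> Ob T \<Longrightarrow> shift T 1 X = Sh T X"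
  using Sh_shift[of X 0] by simp

lemma shift_shift:
  assumes "X \<in> Ob T" shows "shift T m (shift T n X) = shift T (m + n) X"
proof (induction m rule: int_induct[where k = 0])
  case (step1 i)
  have "shift T (i + 1) (shift T n X) = Sh T (shift T i (shift T n X))"
    using Sh_shift assms by simp
  also have "\<dots> = shift T (i + n + 1) X" using step1 Sh_shift[of X "i + n"] assms by simp
  finally show ?case by (simp add: algebra_simps)
next
  case (step2 i)
  have "Sh T (shift T (i - 1) (shift T n X)) = shift T i (shift T n X)"
    using Sh_shift[of "shift T n X" "i - 1"] assms by simp
  also have "\<dots> = Sh T (shift T (i - 1 + n) X)"
    using step2 Sh_shift[of X "i - 1 + n"] assms by simp
  finally show ?case using assms Sh_inj by simp
qed simp

lemma shift_Sh: "X \<in> Ob T \<Longrightarrow> shift T n (Sh T X) = shift T (n + 1) X"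
  using shift_shift[of X n 1] by simp

lemma orth_shift_iff:
  assumes "P \<in> Ob T" "Q \<in> Ob T"
  shows "orth (shift T n P) (shift T n Q) \<longleftrightarrow> orth P Q"
proof (induction n rule: int_induct[where k = 0])
  case (step1 i)
  then show ?case using orth_Sh_iff[of "shift T i P" "shift T i Q"] assms by (simp add: Sh_shift)
next
  case (step2 i)
  then show ?case
    using orth_Sh_iff[of "shift T (i - 1) P" "shift T (i - 1) Q"] assms by (simp add: Sh_shift)
qed simp

lemma orth_shift_right:
  assumes "P \<in> Ob T" "Q \<in> Ob T"
  shows "orth P (shift T n Q) \<longleftrightarrow> orth (shift T (- n) P) Q"
  using orth_shift_iff[of P "shift T n Q" "- n"] assms by (simp add: shift_shift)

lemma mem_perp_iff:
  assumes "X \<in> Ob T"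
  shows "Y \<in> perp T X I \<longleftrightarrow> Y \<in> Ob T \<and> (\<forall>i\<in>I. orth X (shift T i Y))"
proof -
  have "Hom T X (shift T i Y) = {Zero T X (shift T i Y)} \<longleftrightarrow> orth X (shift T i Y)" if "Y \<in> Ob T" for i
    using Hom_eq_Zero_iff assms that by simp
  then show ?thesis by (auto simp only: perp_def mem_Collect_eq)
qed

lemma perp_extension:
  assumes "X \<in> Ob T" "triangle A B C u v w" "A \<in> perp T X I" "C \<in> perp T X I"
  shows "B \<in> perp T X I"
proof -
  have ob: "A \<in> Ob T" "B \<in> Ob T" "C \<in> Ob T" using assms(2) by (auto simp: triangle_def Hom_iff)
  have "orth X (shift T i B)" if "i \<in> I" for i
  proof -
    have "orth (shift T (- i) X) A" "orth (shift T (- i) X) C"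
      using assms that ob by (auto simp: mem_perp_iff orth_shift_right)
    then show ?thesis using orth_middle_right[OF assms(2)] assms(1) ob orth_shift_right by blast
  qed
  then show ?thesis using assms(1) ob by (simp add: mem_perp_iff)
qed

lemma perp_closed_under_summands:
  assumes "X \<in> Ob T"
  shows "closed_under_summands T (perp T X I)"
  unfolding closed_under_summands_def
proof (intro allI ballI impI)
  fix A B S assume S: "S \<in> perp T X I" and d: "direct_sum T A B S"
  have ob: "A \<in> Ob T" "S \<in> Ob T" using d by (auto simp: direct_sum_def)
  then show "A \<in> perp T X I"
    using S orth_direct_sum_right[OF d] assms by (auto simp: mem_perp_iff orth_shift_right)
qed


section \<open>Coproducts in triangulated categories\<close>

lemma coproduct_Sh:
  assumes C: "coproduct T J X C \<iota>"
  shows "coproduct T J (\<lambda>j. Sh T (X j)) (Sh T C) (\<lambda>j. ShM T (\<iota> j))"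
proof (rule coproductI)
  show "Sh T C \<in> Ob T" using coproduct_D[OF C] by simp
  show "Sh T (X j) \<in> Ob T" if "j \<in> J" for j using coproduct_D[OF C] that by simp
  show "ShM T (\<iota> j) \<in> Hom T (Sh T (X j)) (Sh T C)" if "j \<in> J" for j
    using coproduct_D[OF C] that shM_Hom by blast
next
  fix Z h assume "Z \<in> Ob T" and h: "\<And>j. j \<in> J \<Longrightarrow> h j \<in> Hom T (Sh T (X j)) Z"
  then obtain Z' where Z: "Z' \<in> Ob T" "Sh T Z' = Z" using Sh_surj by blast
  have "\<exists>h'. h' \<in> Hom T (X j) Z' \<and> ShM T h' = h j" if "j \<in> J" for j
    using shM_surj[of "h j" "X j" Z'] h[OF that] Z coproduct_D(2)[OF C that] by blast
  then obtain h' where h': "\<And>j. j \<in> J \<Longrightarrow> h' j \<in> Hom T (X j) Z'" "\<And>j. j \<in> J \<Longrightarrow> ShM T (h' j) = h j"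
    by metis
  obtain f where f: "f \<in> Hom T C Z'" "\<And>j. j \<in> J \<Longrightarrow> f \<cdot> \<iota> j = h' j"
    using coproduct_map[OF C Z(1) h'(1)] by blast
  have "ShM T f \<cdot> ShM T (\<iota> j) = h j" if "j \<in> J" for j
    using shM_comp[OF coproduct_D(3)[OF C that] f(1)] f(2)[OF that] h'(2)[OF that] by simp
  then show "\<exists>f\<in>Hom T (Sh T C) Z. \<forall>j\<in>J. f \<cdot> ShM T (\<iota> j) = h j"
    using shM_Hom[OF f(1)] Z(2) by blast
next
  fix Z f g
  assume f: "f \<in> Hom T (Sh T C) Z" and g: "g \<in> Hom T (Sh T C) Z"
    and eq: "\<And>j. j \<in> J \<Longrightarrow> f \<cdot> ShM T (\<iota> j) = g \<cdot> ShM T (\<iota> j)"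
  have ZO: "Z \<in> Ob T" using f by (simp add: Hom_iff)
  then obtain Z' where Z: "Z' \<in> Ob T" "Sh T Z' = Z" using Sh_surj by blast
  have CO: "C \<in> Ob T" using coproduct_D[OF C] by blast
  obtain f' where f': "f' \<in> Hom T C Z'" "ShM T f' = f" using shM_surj[of f C Z'] f Z CO by blast
  obtain g' where g': "g' \<in> Hom T C Z'" "ShM T g' = g" using shM_surj[of g C Z'] g Z CO by blast
  have "f' \<cdot> \<iota> j = g' \<cdot> \<iota> j" if "j \<in> J" for j
  proof -
    have i: "\<iota> j \<in> Hom T (X j) C" using coproduct_D[OF C] that by blast
    have "ShM T (f' \<cdot> \<iota> j) = ShM T (g' \<cdot> \<iota> j)"
      using shM_comp[OF i f'(1)] shM_comp[OF i g'(1)] f'(2) g'(2) eq[OF that] by simp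
    then show ?thesis by (rule shM_inj[rotated 2]) (use i f' g' in \<open>simp_all add: Hom_iff\<close>)
  qed
  then have "f' = g'" by (rule coproduct_eq[OF C f'(1) g'(1)])
  then show "f = g" using f' g' by simp
qed

lemma coproduct_unSh:
  assumes C': "coproduct T J (\<lambda>j. Sh T (X j)) (Sh T C) \<iota>'"
    and CO: "C \<in> Ob T" and XO: "\<And>j. j \<in> J \<Longrightarrow> X j \<in> Ob T"
  obtains \<iota> where "coproduct T J X C \<iota>"
proof -
  have "\<exists>i. i \<in> Hom T (X j) C \<and> ShM T i = \<iota>' j" if "j \<in> J" for j
    using shM_surj[of "\<iota>' j" "X j" C] coproduct_D(3)[OF C' that] XO[OF that] CO by blast
  then obtain \<iota> where i: "\<And>j. j \<in> J \<Longrightarrow> \<iota> j \<in> Hom T (X j) C" "\<And>j. j \<in> J \<Longrightarrow> ShM T (\<iota> j) = \<iota>' j"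
    by metis
  have "coproduct T J X C \<iota>"
  proof (rule coproductI)
    fix Z h assume Z: "Z \<in> Ob T" and h: "\<And>j. j \<in> J \<Longrightarrow> h j \<in> Hom T (X j) Z"
    obtain g where g: "g \<in> Hom T (Sh T C) (Sh T Z)" "\<And>j. j \<in> J \<Longrightarrow> g \<cdot> \<iota>' j = ShM T (h j)"
      using coproduct_map[OF C', of "Sh T Z" "\<lambda>j. ShM T (h j)"] Z h shM_Hom by auto
    obtain f where f: "f \<in> Hom T C Z" "ShM T f = g" using shM_surj[OF g(1) CO Z] .
    have "f \<cdot> \<iota> j = h j" if "j \<in> J" for j
    proof -
      have "ShM T (f \<cdot> \<iota> j) = ShM T (h j)"
        using shM_comp[OF i(1)[OF that] f(1)] f(2) i(2)[OF that] g(2)[OF that] by simp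
      then show ?thesis
        by (rule shM_inj[rotated 2]) (use i(1)[OF that] f h[OF that] in \<open>simp_all add: Hom_iff\<close>)
    qed
    then show "\<exists>f\<in>Hom T C Z. \<forall>j\<in>J. f \<cdot> \<iota> j = h j" using f(1) by blast
  next
    fix Z f g
    assume f: "f \<in> Hom T C Z" and g: "g \<in> Hom T C Z"
      and eq: "\<And>j. j \<in> J \<Longrightarrow> f \<cdot> \<iota> j = g \<cdot> \<iota> j"
    have "ShM T f = ShM T g"
    proof (rule coproduct_eq[OF C' shM_Hom[OF f] shM_Hom[OF g]])
      fix j assume j: "j \<in> J"
      show "ShM T f \<cdot> \<iota>' j = ShM T g \<cdot> \<iota>' j"
        using shM_comp[OF i(1)[OF j] f] shM_comp[OF i(1)[OF j] g] eq[OF j] i(2)[OF j] by simp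
    qed
    then show "f = g" by (rule shM_inj[rotated 2]) (use f g in \<open>simp_all add: Hom_iff\<close>)
  qed (use CO XO i in auto)
  then show thesis using that by blast
qed

text \<open>A coproduct of triangles is a triangle: the cone of a coproduct of maps is a coproduct of
  their cones. The proof is the five lemma for the functors \<open>Hom(-, Z)\<close>.\<close>

lemma cone_of_coproduct:
  assumes A: "coproduct T J A C \<iota>" and B: "coproduct T J B C' \<iota>'"
    and f: "\<And>j. j \<in> J \<Longrightarrow> f j \<in> Hom T (A j) (B j)"
    and \<phi>: "\<phi> \<in> Hom T C C'" "\<And>j. j \<in> J \<Longrightarrow> \<phi> \<cdot> \<iota> j = \<iota>' j \<cdot> f j"
    and D: "\<And>j. j \<in> J \<Longrightarrow> cone_of (f j) (D j)" and E: "cone_of \<phi> E"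
  obtains \<kappa> where "coproduct T J D E \<kappa>"
proof -
  obtain v w where t: "triangle C C' E \<phi> v w" using cone_ofD[OF E \<phi>(1)] .
  have "\<exists>p. triangle (A j) (B j) (D j) (f j) (fst p) (snd p)" if "j \<in> J" for j
    using cone_ofD[OF D[OF that] f[OF that]] by (metis fst_conv snd_conv)
  then obtain p where p: "\<And>j. j \<in> J \<Longrightarrow> triangle (A j) (B j) (D j) (f j) (fst (p j)) (snd (p j))"
    by metis
  define v' w' where "v' = fst \<circ> p" and "w' = snd \<circ> p"
  have t': "triangle (A j) (B j) (D j) (f j) (v' j) (w' j)" if "j \<in> J" for j
    using p[OF that] by (simp add: v'_def w'_def)
  have "\<exists>k. k \<in> Hom T (D j) E \<and> k \<cdot> v' j = v \<cdot> \<iota>' j \<and> ShM T (\<iota> j) \<cdot> w' j = w \<cdot> k" if "j \<in> J" for j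
    using triangle_morphism[OF t'[OF that] t coproduct_D(3)[OF A that] coproduct_D(3)[OF B that]]
      \<phi>(2)[OF that] by metis
  then obtain \<kappa> where k: "\<And>j. j \<in> J \<Longrightarrow> \<kappa> j \<in> Hom T (D j) E"
    "\<And>j. j \<in> J \<Longrightarrow> \<kappa> j \<cdot> v' j = v \<cdot> \<iota>' j" "\<And>j. j \<in> J \<Longrightarrow> ShM T (\<iota> j) \<cdot> w' j = w \<cdot> \<kappa> j"
    by metis
  have i: "\<iota> j \<in> Hom T (A j) C" "\<iota>' j \<in> Hom T (B j) C'" if "j \<in> J" for j
    using coproduct_D[OF A] coproduct_D[OF B] that by blast+
  have m: "v \<in> Hom T C' E" "w \<in> Hom T E (Sh T C)" using t by (auto simp: triangle_def)
  have m': "v' j \<in> Hom T (B j) (D j)" "w' j \<in> Hom T (D j) (Sh T (A j))" if "j \<in> J" for j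
    using t'[OF that] by (auto simp: triangle_def)
  note SA = coproduct_Sh[OF A] and SB = coproduct_Sh[OF B]
  have "coproduct T J D E \<kappa>"
  proof (rule coproductI)
    fix Z h assume Z: "Z \<in> Ob T" and h: "\<And>j. j \<in> J \<Longrightarrow> h j \<in> Hom T (D j) Z"
    obtain e where e: "e \<in> Hom T C' Z" "\<And>j. j \<in> J \<Longrightarrow> e \<cdot> \<iota>' j = h j \<cdot> v' j"
      using coproduct_map[OF B Z, of "\<lambda>j. h j \<cdot> v' j"] comp_Hom[OF m'(1) h] by blast
    have "e \<cdot> \<phi> = Zero T C Z"
    proof (rule coproduct_eq[OF A])
      fix j assume j: "j \<in> J"
      have "(e \<cdot> \<phi>) \<cdot> \<iota> j = (e \<cdot> \<iota>' j) \<cdot> f j"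
        using e \<phi>(1) \<phi>(2)[OF j] i[OF j] f[OF j] by (simp add: Hom_iff)
      also have "\<dots> = h j \<cdot> (v' j \<cdot> f j)" using e(2)[OF j] h[OF j] m'[OF j] f[OF j] by (simp add: Hom_iff)
      also have "\<dots> = Zero T C Z \<cdot> \<iota> j"
        using triangle_vanishing(1)[OF t'[OF j]] h[OF j] i[OF j] f[OF j] by (simp add: Hom_iff)
      finally show "(e \<cdot> \<phi>) \<cdot> \<iota> j = Zero T C Z \<cdot> \<iota> j" .
    qed (use e \<phi> in \<open>auto simp: Hom_iff\<close>)
    then obtain g where g: "g \<in> Hom T E Z" "e = g \<cdot> v" using weak_cokernel[OF t e(1)] by blast
    have "\<exists>x. x \<in> Hom T (Sh T (A j)) Z \<and> g \<cdot> \<kappa> j \<oplus> Neg T (h j) = x \<cdot> w' j" if j: "j \<in> J" for j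
    proof -
      have "(g \<cdot> \<kappa> j) \<cdot> v' j = (g \<cdot> v) \<cdot> \<iota>' j"
        using k(1,2)[OF j] g m m'[OF j] i[OF j] by (simp add: Hom_iff)
      then have "(g \<cdot> \<kappa> j) \<cdot> v' j = h j \<cdot> v' j" using e(2)[OF j] g(2) by simp
      then have "(g \<cdot> \<kappa> j \<oplus> Neg T (h j)) \<cdot> v' j = h j \<cdot> v' j \<oplus> Neg T (h j \<cdot> v' j)"
        using k(1)[OF j] g h[OF j] m'[OF j] by (simp add: Hom_iff distrib_right)
      also have "\<dots> = Zero T (B j) Z" using plus_neg comp_Hom m'[OF j] h[OF j] by blast
      finally have "(g \<cdot> \<kappa> j \<oplus> Neg T (h j)) \<cdot> v' j = Zero T (B j) Z" .
      moreover have "g \<cdot> \<kappa> j \<oplus> Neg T (h j) \<in> Hom T (D j) Z"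
        using k(1)[OF j] g h[OF j] by (simp add: Hom_iff)
      ultimately show ?thesis using weak_cokernel[OF triangle_rotate[OF t'[OF j]]] by metis
    qed
    then obtain x where x: "\<And>j. j \<in> J \<Longrightarrow> x j \<in> Hom T (Sh T (A j)) Z"
      "\<And>j. j \<in> J \<Longrightarrow> g \<cdot> \<kappa> j \<oplus> Neg T (h j) = x j \<cdot> w' j" by metis
    obtain y where y: "y \<in> Hom T (Sh T C) Z" "\<And>j. j \<in> J \<Longrightarrow> y \<cdot> ShM T (\<iota> j) = x j"
      using coproduct_map[OF SA Z x(1)] by blast
    have "(g \<oplus> Neg T (y \<cdot> w)) \<cdot> \<kappa> j = h j" if j: "j \<in> J" for j
    proof -
      have "(y \<cdot> w) \<cdot> \<kappa> j = (y \<cdot> ShM T (\<iota> j)) \<cdot> w' j"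
        using y(1) m k(1)[OF j] k(3)[OF j, symmetric] i[OF j] m'[OF j] by (simp add: Hom_iff)
      then have "(g \<oplus> Neg T (y \<cdot> w)) \<cdot> \<kappa> j = g \<cdot> \<kappa> j \<oplus> Neg T (x j \<cdot> w' j)"
        using y(1) y(2)[OF j] m k(1)[OF j] g by (simp add: Hom_iff distrib_right)
      also have "\<dots> = h j"
        using minus_minus[OF comp_Hom[OF k(1)[OF j] g(1)] h[OF j] x(2)[OF j]] .
      finally show ?thesis .
    qed
    moreover have "g \<oplus> Neg T (y \<cdot> w) \<in> Hom T E Z" using g y m by (simp add: Hom_iff)
    ultimately show "\<exists>f\<in>Hom T E Z. \<forall>j\<in>J. f \<cdot> \<kappa> j = h j" by blast
  next
    fix Z g1 g2
    assume g12: "g1 \<in> Hom T E Z" "g2 \<in> Hom T E Z" "\<And>j. j \<in> J \<Longrightarrow> g1 \<cdot> \<kappa> j = g2 \<cdot> \<kappa> j"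
    define g where "g = g1 \<oplus> Neg T g2"
    have g: "g \<in> Hom T E Z" using g12 by (simp add: g_def Hom_iff)
    have g0: "g \<cdot> \<kappa> j = Zero T (D j) Z" if j: "j \<in> J" for j
    proof -
      have "g \<cdot> \<kappa> j = g1 \<cdot> \<kappa> j \<oplus> Neg T (g1 \<cdot> \<kappa> j)"
        using g12(1,2) g12(3)[OF j] k(1)[OF j] by (simp add: g_def Hom_iff distrib_right)
      then show ?thesis using plus_neg[OF comp_Hom[OF k(1)[OF j] g12(1)]] by simp
    qed
    have "g \<cdot> v = Zero T C' Z"
    proof (rule coproduct_eq[OF B])
      fix j assume j: "j \<in> J"
      have "(g \<cdot> v) \<cdot> \<iota>' j = (g \<cdot> \<kappa> j) \<cdot> v' j"
        using g m k(1,2)[OF j] i[OF j] m'[OF j] by (simp add: Hom_iff)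
      also have "\<dots> = Zero T C' Z \<cdot> \<iota>' j" using g0[OF j] g m'[OF j] i[OF j] by (simp add: Hom_iff)
      finally show "(g \<cdot> v) \<cdot> \<iota>' j = Zero T C' Z \<cdot> \<iota>' j" .
    qed (use g m in \<open>auto simp: Hom_iff\<close>)
    then obtain y where y: "y \<in> Hom T (Sh T C) Z" "g = y \<cdot> w"
      using weak_cokernel[OF triangle_rotate[OF t] g] by blast
    have "\<exists>x. x \<in> Hom T (Sh T (B j)) Z \<and> y \<cdot> ShM T (\<iota> j) = x \<cdot> ShM T (f j)" if j: "j \<in> J" for j
    proof -
      have "(y \<cdot> ShM T (\<iota> j)) \<cdot> w' j = (y \<cdot> w) \<cdot> \<kappa> j"
        using y m k(1)[OF j] k(3)[OF j] i[OF j] m'[OF j] by (simp add: Hom_iff)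
      then have "(y \<cdot> ShM T (\<iota> j)) \<cdot> w' j = Zero T (D j) Z" using g0[OF j] y by simp
      moreover have "y \<cdot> ShM T (\<iota> j) \<in> Hom T (Sh T (A j)) Z" using y i[OF j] by (simp add: Hom_iff)
      ultimately show ?thesis using weak_cokernel_shift[OF t'[OF j]] by metis
    qed
    then obtain x where x: "\<And>j. j \<in> J \<Longrightarrow> x j \<in> Hom T (Sh T (B j)) Z"
      "\<And>j. j \<in> J \<Longrightarrow> y \<cdot> ShM T (\<iota> j) = x j \<cdot> ShM T (f j)" by metis
    have ZO: "Z \<in> Ob T" using g by (simp add: Hom_iff)
    obtain z where z: "z \<in> Hom T (Sh T C') Z" "\<And>j. j \<in> J \<Longrightarrow> z \<cdot> ShM T (\<iota>' j) = x j"
      using coproduct_map[OF SB ZO x(1)] by blast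
    have "y = z \<cdot> ShM T \<phi>"
    proof (rule coproduct_eq[OF SA y(1)])
      fix j assume j: "j \<in> J"
      have "(z \<cdot> ShM T \<phi>) \<cdot> ShM T (\<iota> j) = z \<cdot> ShM T (\<phi> \<cdot> \<iota> j)"
        using z(1) \<phi>(1) i[OF j] by (simp add: Hom_iff shM_comp_arr)
      also have "\<dots> = (z \<cdot> ShM T (\<iota>' j)) \<cdot> ShM T (f j)"
        using z(1) \<phi>(2)[OF j] i[OF j] f[OF j] by (simp add: Hom_iff shM_comp_arr)
      finally show "y \<cdot> ShM T (\<iota> j) = (z \<cdot> ShM T \<phi>) \<cdot> ShM T (\<iota> j)"
        using z(2)[OF j] x(2)[OF j] by simp
    qed (use z \<phi> in \<open>simp add: Hom_iff\<close>)
    then have "g = z \<cdot> (ShM T \<phi> \<cdot> w)" using y z \<phi> m by (simp add: Hom_iff)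
    then have "g = Zero T E Z" using triangle_vanishing(3)[OF t] z m by (simp add: Hom_iff)
    then show "g1 = g2" using eq_iff_minus[OF g12(1,2)] by (simp add: g_def)
  next
    show "E \<in> Ob T" using cone_of_Ob[OF E] .
    show "D j \<in> Ob T" "\<kappa> j \<in> Hom T (D j) E" if "j \<in> J" for j
      using k(1)[OF that] by (simp_all add: Hom_iff)
  qed
  then show thesis using that by blast
qed

end


section \<open>Homotopy colimits of sequences\<close>

context triangulated_category
begin

text \<open>For a sequence \<open>X 0 \<rightarrow> X 1 \<rightarrow> \<dots>\<close> with transition maps \<open>s m\<close>, and a coproduct \<open>S\<close> of its
  terms with coprojections \<open>\<iota> m\<close>, the map \<open>d\<close> is ``identity minus shift'' on \<open>S\<close>.\<close>

definition telescope_map ::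
    "(nat \<Rightarrow> 'a) \<Rightarrow> (nat \<Rightarrow> 'b) \<Rightarrow> 'a \<Rightarrow> (nat \<Rightarrow> 'b) \<Rightarrow> 'b \<Rightarrow> bool" where
  "telescope_map X s S \<iota> d \<longleftrightarrow> coproduct T UNIV X S \<iota> \<and> d \<in> Hom T S S \<and>
     (\<forall>m. d \<cdot> \<iota> m = \<iota> m \<oplus> Neg T (\<iota> (Suc m) \<cdot> s m))"

text \<open>A Milnor (homotopy) colimit of the sequence is a cone of that map. It is a relation between
  sequences and objects, since cones and coproducts are unique only up to isomorphism.\<close>

definition hocolim :: "(nat \<Rightarrow> 'a) \<Rightarrow> (nat \<Rightarrow> 'b) \<Rightarrow> 'a \<Rightarrow> bool" where
  "hocolim X s H \<longleftrightarrow> (\<exists>S \<iota> d. telescope_map X s S \<iota> d \<and> cone_of d H)"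

lemma telescope_map_exists:
  assumes C: "coproduct T UNIV X S \<iota>" and s: "\<And>m. s m \<in> Hom T (X m) (X (Suc m))"
  obtains d where "telescope_map X s S \<iota> d"
proof -
  have SO: "S \<in> Ob T" and i: "\<iota> m \<in> Hom T (X m) S" for m using coproduct_D[OF C] by auto
  define h where "h = (\<lambda>m. \<iota> m \<oplus> Neg T (\<iota> (Suc m) \<cdot> s m))"
  have h: "h m \<in> Hom T (X m) S" for m
    using i[of m] i[of "Suc m"] s[of m] by (simp add: h_def Hom_iff)
  obtain d where "d \<in> Hom T S S" "\<And>m. d \<cdot> \<iota> m = h m"
    using coproduct_map[OF C SO h] by auto
  then have "telescope_map X s S \<iota> d" using C unfolding telescope_map_def h_def by simp
  then show thesis by (rule that)
qed

lemma minus_cancel_left: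
  assumes "f \<in> Hom T X Y" "g \<in> Hom T X Y" "h \<in> Hom T X Y"
  shows "(f \<oplus> Neg T g) \<oplus> Neg T (f \<oplus> Neg T h) = h \<oplus> Neg T g"
proof -
  define x where "x = f \<oplus> Neg T h"
  have H: "Neg T g \<in> Hom T X Y" "x \<in> Hom T X Y" "Neg T x \<in> Hom T X Y"
    using assms by (auto simp: x_def Hom_iff)
  have "f \<oplus> Neg T x = h" using minus_minus[OF assms(1,3)] by (simp add: x_def)
  then have "h \<oplus> Neg T g = (Neg T x \<oplus> f) \<oplus> Neg T g" using plus_commute H assms by metis
  also have "\<dots> = Neg T x \<oplus> (f \<oplus> Neg T g)" using plus_assoc H assms by metis
  also have "\<dots> = (f \<oplus> Neg T g) \<oplus> Neg T x" using plus_commute plus_Hom H assms by metis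
  finally show ?thesis by (simp add: x_def)
qed

text \<open>The homotopy colimit of a constant sequence is the constant value: on a countable copower
  \<open>S\<close> of \<open>X\<close>, the map ``identity minus shift'' is a split monomorphism whose cokernel is
  the codiagonal \<open>S \<rightarrow> X\<close>.\<close>

lemma cone_of_constant_telescope:
  assumes t: "telescope_map (\<lambda>_. X) (\<lambda>_. Id T X) S \<iota> d"
  shows "cone_of d X"
proof -
  have C: "coproduct T UNIV (\<lambda>_. X) S \<iota>" and d: "d \<in> Hom T S S"
    and di0: "d \<cdot> \<iota> m = \<iota> m \<oplus> Neg T (\<iota> (Suc m) \<cdot> Id T X)" for m
    using t by (auto simp: telescope_map_def)
  have SO: "S \<in> Ob T" and XO: "X \<in> Ob T" and i: "\<iota> m \<in> Hom T X S" for m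
    using coproduct_D[OF C] by auto
  have di: "d \<cdot> \<iota> m = \<iota> m \<oplus> Neg T (\<iota> (Suc m))" for m
    using di0[of m] i by (simp add: Hom_iff)
  obtain e where e: "e \<in> Hom T S X" "\<And>m. e \<cdot> \<iota> m = Id T X"
    using coproduct_map[OF C XO, of "\<lambda>_. Id T X"] id_Hom[OF XO] by auto
  \<comment> \<open>\<open>\<rho> m\<close> is minus the sum of the first \<open>m\<close> coprojections.\<close>
  define \<rho> where "\<rho> = rec_nat (Zero T X S) (\<lambda>m x. x \<oplus> Neg T (\<iota> m))"
  have rho0: "\<rho> 0 = Zero T X S" and rhoS: "\<rho> (Suc m) = \<rho> m \<oplus> Neg T (\<iota> m)" for m
    by (simp_all add: \<rho>_def)
  have rho: "\<rho> m \<in> Hom T X S" for m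
  proof (induction m)
    case (Suc m)
    then show ?case using i[of m] by (simp add: rhoS Hom_iff)
  qed (use XO SO in \<open>simp add: rho0 zero_Hom\<close>)
  obtain r where r: "r \<in> Hom T S S" "\<And>m. r \<cdot> \<iota> m = \<rho> m"
    using coproduct_map[OF C SO, of \<rho>] rho by auto
  have rd: "r \<cdot> d = Id T S"
  proof (rule coproduct_eq[OF C comp_Hom[OF d r(1)] id_Hom[OF SO]])
    fix m
    have "(r \<cdot> d) \<cdot> \<iota> m = r \<cdot> (\<iota> m \<oplus> Neg T (\<iota> (Suc m)))"
      using r(1) d i[of m] by (simp add: Hom_iff di)
    also have "\<dots> = \<rho> m \<oplus> Neg T (\<rho> (Suc m))"
      using r(1) i[of m] i[of "Suc m"] by (simp add: Hom_iff distrib_left r(2))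
    also have "\<dots> = \<iota> m" using minus_minus[OF rho[of m] i[of m]] by (simp add: rhoS)
    finally show "(r \<cdot> d) \<cdot> \<iota> m = Id T S \<cdot> \<iota> m" using i[of m] by (simp add: Hom_iff)
  qed
  have drho: "d \<cdot> \<rho> m = \<iota> m \<oplus> Neg T (\<iota> 0)" for m
  proof (induction m)
    case 0
    then show ?case using d XO plus_neg[OF i[of 0]] by (simp add: rho0 Hom_iff)
  next
    case (Suc m)
    have "d \<cdot> \<rho> (Suc m) = d \<cdot> \<rho> m \<oplus> Neg T (d \<cdot> \<iota> m)"
      using d rho[of m] i[of m] by (simp add: rhoS Hom_iff distrib_left)
    also have "\<dots> = \<iota> (Suc m) \<oplus> Neg T (\<iota> 0)"
      using minus_cancel_left[OF i[of m] i[of 0] i[of "Suc m"]] by (simp add: Suc di)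
    finally show ?case .
  qed
  obtain G g w where G: "triangle S S G d g w" using triangle_exists[OF d] .
  have g: "g \<in> Hom T S G" and w: "w \<in> Hom T G (Sh T S)" and GO: "G \<in> Ob T"
    using G by (auto simp: triangle_def Hom_iff)
  have "w = ShM T (r \<cdot> d) \<cdot> w" using w SO by (simp add: rd shM_id Hom_iff)
  also have "\<dots> = ShM T r \<cdot> (ShM T d \<cdot> w)" using w r(1) d by (simp add: Hom_iff shM_comp_arr)
  also have "\<dots> = Zero T G (Sh T S)"
    using triangle_vanishing(3)[OF G] r(1) GO by (simp add: Hom_iff)
  finally have w0: "w = Zero T G (Sh T S)" .
  have "e \<cdot> d = Zero T S X"
  proof (rule coproduct_eq[OF C comp_Hom[OF d e(1)] zero_Hom[OF SO XO]])
    fix m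
    have "(e \<cdot> d) \<cdot> \<iota> m = e \<cdot> (\<iota> m \<oplus> Neg T (\<iota> (Suc m)))"
      using e(1) d i[of m] by (simp add: Hom_iff di)
    also have "\<dots> = Id T X \<oplus> Neg T (Id T X)"
      using e(1) i[of m] i[of "Suc m"] by (simp add: Hom_iff distrib_left e(2))
    also have "\<dots> = Zero T X X" using plus_neg id_Hom XO by blast
    finally show "(e \<cdot> d) \<cdot> \<iota> m = Zero T S X \<cdot> \<iota> m" using i[of m] XO by (simp add: Hom_iff)
  qed
  then obtain c where c: "c \<in> Hom T G X" "e = c \<cdot> g" using weak_cokernel[OF G e(1)] by blast
  define t where "t = g \<cdot> \<iota> 0"
  have tH: "t \<in> Hom T X G" using comp_Hom[OF i g] by (simp add: t_def)
  have ct: "c \<cdot> t = Id T X" using e(2)[of 0] c g i[of 0] by (simp add: t_def Hom_iff)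
  have gi: "g \<cdot> \<iota> m = g \<cdot> \<iota> 0" for m
  proof -
    have "g \<cdot> \<iota> m \<oplus> Neg T (g \<cdot> \<iota> 0) = g \<cdot> (d \<cdot> \<rho> m)"
      using g i[of m] i[of 0] by (simp add: drho Hom_iff distrib_left)
    also have "\<dots> = (g \<cdot> d) \<cdot> \<rho> m" using g d rho[of m] by (simp add: Hom_iff)
    also have "\<dots> = Zero T X G"
      using triangle_vanishing(1)[OF G] rho[of m] GO by (simp add: Hom_iff)
    finally show ?thesis using eq_iff_minus comp_Hom[OF i g] by blast
  qed
  have tcg: "(t \<cdot> c) \<cdot> g = g"
  proof (rule coproduct_eq[OF C comp_Hom[OF g comp_Hom[OF c(1) tH]] g])
    fix m
    have "((t \<cdot> c) \<cdot> g) \<cdot> \<iota> m = t \<cdot> (e \<cdot> \<iota> m)"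
      using g c tH i[of m] by (simp add: Hom_iff)
    also have "\<dots> = g \<cdot> \<iota> m" using tH gi[of m] by (simp add: e(2) t_def Hom_iff)
    finally show "((t \<cdot> c) \<cdot> g) \<cdot> \<iota> m = g \<cdot> \<iota> m" .
  qed
  have D: "t \<cdot> c \<oplus> Neg T (Id T G) \<in> Hom T G G" using tH c GO by (simp add: Hom_iff)
  have "(t \<cdot> c \<oplus> Neg T (Id T G)) \<cdot> g = (t \<cdot> c) \<cdot> g \<oplus> Neg T g"
    using tH c g GO distrib_right[of g "t \<cdot> c" "Neg T (Id T G)"] by (simp add: Hom_iff)
  then have "(t \<cdot> c \<oplus> Neg T (Id T G)) \<cdot> g = Zero T S G" using tcg plus_neg[OF g] by simp
  then obtain y where "y \<in> Hom T (Sh T S) G" "t \<cdot> c \<oplus> Neg T (Id T G) = y \<cdot> w"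
    using weak_cokernel[OF triangle_rotate[OF G] D] by blast
  then have "t \<cdot> c \<oplus> Neg T (Id T G) = Zero T G G" using w0 GO by (simp add: Hom_iff)
  then have tc: "t \<cdot> c = Id T G" using eq_iff_minus[OF comp_Hom[OF c(1) tH] id_Hom[OF GO]] by simp
  have "iso T c" using c tH ct tc unfolding iso_def by (auto simp: Hom_iff intro!: bexI[of _ t])
  then show ?thesis using G c(1) cone_of_iso[of d G c X] unfolding cone_of_def by blast
qed

text \<open>Dropping the first term of a sequence does not change its homotopy colimit; only the
  consequence for vanishing of maps out of a fixed object is recorded, for which it suffices that
  the one colimit be a retract of the other. With \<open>j\<close> the inclusion of the tail, \<open>p\<close> the
  projection onto it, and \<open>q\<close> equal to \<open>p\<close> except that it sends the first summand along
  \<open>s 0\<close>, the pair \<open>(j p, j q)\<close> is chain homotopic to the identity of \<open>d\<close> by the projection \<open>k\<close>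
  onto the first summand.\<close>

lemma orth_hocolim_tail:
  assumes H: "hocolim X s H" and H': "hocolim (\<lambda>m. X (Suc m)) (\<lambda>m. s (Suc m)) H'"
    and s: "\<And>m. s m \<in> Hom T (X m) (X (Suc m))" and o: "orth P H'"
  shows "orth P H"
proof -
  obtain S \<iota> d where C: "coproduct T UNIV X S \<iota>" and d: "d \<in> Hom T S S"
    and di: "\<And>m. d \<cdot> \<iota> m = \<iota> m \<oplus> Neg T (\<iota> (Suc m) \<cdot> s m)" and cd: "cone_of d H"
    using H unfolding hocolim_def telescope_map_def by blast
  obtain S' \<iota>' d' where C': "coproduct T UNIV (\<lambda>m. X (Suc m)) S' \<iota>'" and d': "d' \<in> Hom T S' S'"
    and di': "\<And>m. d' \<cdot> \<iota>' m = \<iota>' m \<oplus> Neg T (\<iota>' (Suc m) \<cdot> s (Suc m))" and cd': "cone_of d' H'"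
    using H' unfolding hocolim_def telescope_map_def by blast
  have SO: "S \<in> Ob T" and XO: "X m \<in> Ob T" and i: "\<iota> m \<in> Hom T (X m) S" for m
    using coproduct_D[OF C] by auto
  have SO': "S' \<in> Ob T" and i': "\<iota>' m \<in> Hom T (X (Suc m)) S'" for m
    using coproduct_D[OF C'] by auto
  obtain j where j: "j \<in> Hom T S' S" "\<And>m. j \<cdot> \<iota>' m = \<iota> (Suc m)"
    using coproduct_map[OF C' SO, of "\<lambda>m. \<iota> (Suc m)"] i by auto
  define hp where "hp = case_nat (Zero T (X 0) S') \<iota>'"
  define hq where "hq = case_nat (\<iota>' 0 \<cdot> s 0) \<iota>'"
  define hk where "hk = case_nat (\<iota> 0) (\<lambda>m. Zero T (X (Suc m)) S)"
  have "hp m \<in> Hom T (X m) S'" "hq m \<in> Hom T (X m) S'" "hk m \<in> Hom T (X m) S" for m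
    using i' comp_Hom[OF s i'] i XO SO SO' zero_Hom
    by (auto simp: hp_def hq_def hk_def split: nat.split)
  then obtain p q k where p: "p \<in> Hom T S S'" "\<And>m. p \<cdot> \<iota> m = hp m"
    and q: "q \<in> Hom T S S'" "\<And>m. q \<cdot> \<iota> m = hq m" and k: "k \<in> Hom T S S" "\<And>m. k \<cdot> \<iota> m = hk m"
    using coproduct_map[OF C SO', of hp] coproduct_map[OF C SO', of hq] coproduct_map[OF C SO, of hk]
    by (metis UNIV_I)
  have p0: "p \<cdot> \<iota> 0 = Zero T (X 0) S'" and pS: "p \<cdot> \<iota> (Suc m) = \<iota>' m"
    and q0: "q \<cdot> \<iota> 0 = \<iota>' 0 \<cdot> s 0" and qS: "q \<cdot> \<iota> (Suc m) = \<iota>' m"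
    and k0: "k \<cdot> \<iota> 0 = \<iota> 0" and kS: "k \<cdot> \<iota> (Suc m) = Zero T (X (Suc m)) S" for m
    using p(2) q(2) k(2) by (auto simp: hp_def hq_def hk_def)
  have xdi: "x \<cdot> (d \<cdot> \<iota> m) = x \<cdot> \<iota> m \<oplus> Neg T ((x \<cdot> \<iota> (Suc m)) \<cdot> s m)"
    if "x \<in> Hom T S Z" for x Z m
    using that i[of m] i[of "Suc m"] s[of m] by (simp add: di Hom_iff distrib_left)
  have jd: "j \<cdot> d' = d \<cdot> j"
  proof (rule coproduct_eq[OF C' comp_Hom[OF d' j(1)] comp_Hom[OF j(1) d]])
    fix m
    have "(j \<cdot> d') \<cdot> \<iota>' m = j \<cdot> \<iota>' m \<oplus> Neg T ((j \<cdot> \<iota>' (Suc m)) \<cdot> s (Suc m))"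
      using j(1) d' i'[of m] i'[of "Suc m"] s[of "Suc m"] by (simp add: di' Hom_iff distrib_left)
    also have "\<dots> = (d \<cdot> j) \<cdot> \<iota>' m" using j(1) d i'[of m] by (simp add: j(2) di Hom_iff)
    finally show "(j \<cdot> d') \<cdot> \<iota>' m = (d \<cdot> j) \<cdot> \<iota>' m" .
  qed
  have qd: "q \<cdot> d = d' \<cdot> p"
  proof (rule coproduct_eq[OF C comp_Hom[OF d q(1)] comp_Hom[OF p(1) d']])
    fix m
    have L: "(q \<cdot> d) \<cdot> \<iota> m = q \<cdot> \<iota> m \<oplus> Neg T ((q \<cdot> \<iota> (Suc m)) \<cdot> s m)"
      using xdi[OF q(1)] q(1) d i[of m] by (simp add: Hom_iff)
    have R: "(d' \<cdot> p) \<cdot> \<iota> m = d' \<cdot> (p \<cdot> \<iota> m)" using p(1) d' i[of m] by (simp add: Hom_iff)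
    show "(q \<cdot> d) \<cdot> \<iota> m = (d' \<cdot> p) \<cdot> \<iota> m"
    proof (cases m)
      case 0
      then show ?thesis
        using L R plus_neg[OF comp_Hom[OF s[of 0] i'[of 0]]] d' XO by (simp add: q0 qS p0 Hom_iff)
    next
      case (Suc n)
      then show ?thesis using L R by (simp add: qS pS di')
    qed
  qed
  have kd: "k \<cdot> d \<oplus> j \<cdot> p = Id T S"
  proof (rule coproduct_eq[OF C _ id_Hom[OF SO]])
    fix m
    have L: "(k \<cdot> d \<oplus> j \<cdot> p) \<cdot> \<iota> m = (k \<cdot> \<iota> m \<oplus> Neg T ((k \<cdot> \<iota> (Suc m)) \<cdot> s m)) \<oplus> j \<cdot> (p \<cdot> \<iota> m)"
      using xdi[OF k(1)] k(1) d j(1) p(1) i[of m] by (simp add: Hom_iff distrib_right)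
    show "(k \<cdot> d \<oplus> j \<cdot> p) \<cdot> \<iota> m = Id T S \<cdot> \<iota> m"
    proof (cases m)
      case 0
      then show ?thesis using L i[of 0] s[of 0] j(1) by (simp add: k0 kS p0 Hom_iff)
    next
      case (Suc n)
      then show ?thesis using L i[of m] s[of m] XO SO by (simp add: kS pS j(2) Hom_iff)
    qed
  qed (use k d j p in \<open>simp add: Hom_iff\<close>)
  have dk: "d \<cdot> k \<oplus> j \<cdot> q = Id T S"
  proof (rule coproduct_eq[OF C _ id_Hom[OF SO]])
    fix m
    have L: "(d \<cdot> k \<oplus> j \<cdot> q) \<cdot> \<iota> m = d \<cdot> (k \<cdot> \<iota> m) \<oplus> j \<cdot> (q \<cdot> \<iota> m)"
      using k(1) d j(1) q(1) i[of m] by (simp add: Hom_iff distrib_right)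
    show "(d \<cdot> k \<oplus> j \<cdot> q) \<cdot> \<iota> m = Id T S \<cdot> \<iota> m"
    proof (cases m)
      case 0
      define x where "x = \<iota> 1 \<cdot> s 0"
      have x: "x \<in> Hom T (X 0) S" using comp_Hom[OF s[of 0] i[of "Suc 0"]] by (simp add: x_def)
      have "d \<cdot> \<iota> 0 = \<iota> 0 \<oplus> Neg T x" by (simp add: di x_def)
      moreover have "j \<cdot> (\<iota>' 0 \<cdot> s 0) = (j \<cdot> \<iota>' 0) \<cdot> s 0"
        using j(1) i'[of 0] s[of 0] by (simp add: Hom_iff)
      then have "j \<cdot> (\<iota>' 0 \<cdot> s 0) = x" by (simp add: j(2) x_def)
      ultimately have "(d \<cdot> k \<oplus> j \<cdot> q) \<cdot> \<iota> m = (\<iota> 0 \<oplus> Neg T x) \<oplus> x"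
        using L 0 by (simp add: k0 q0)
      also have "\<dots> = \<iota> 0 \<oplus> (Neg T x \<oplus> x)" using plus_assoc i[of 0] x neg_Hom by blast
      also have "Neg T x \<oplus> x = Zero T (X 0) S"
        using plus_commute[OF neg_Hom[OF x] x] plus_neg[OF x] by simp
      finally show ?thesis using 0 i[of 0] by (simp add: Hom_iff)
    next
      case (Suc n)
      then show ?thesis using L i[of m] d XO SO by (simp add: kS qS j(2) Hom_iff)
    qed
  qed (use k d j q in \<open>simp add: Hom_iff\<close>)
  obtain g w where t: "triangle S S H d g w" using cone_ofD[OF cd d] .
  obtain g' w' where t': "triangle S' S' H' d' g' w'" using cone_ofD[OF cd' d'] .
  have g: "g \<in> Hom T S H" "w \<in> Hom T H (Sh T S)" "H \<in> Ob T" using t by (auto simp: triangle_def Hom_iff)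
  have g': "g' \<in> Hom T S' H'" "w' \<in> Hom T H' (Sh T S')" using t' by (auto simp: triangle_def)
  show ?thesis
  proof (rule orthI)
    fix f assume f: "f \<in> Hom T P H"
    have PO: "P \<in> Ob T" using f by (simp add: Hom_iff)
    define y where "y = w \<cdot> f"
    have y: "y \<in> Hom T P (Sh T S)" using f g by (simp add: y_def Hom_iff)
    have "ShM T d \<cdot> y = (ShM T d \<cdot> w) \<cdot> f" using f g d by (simp add: y_def Hom_iff)
    then have dy: "ShM T d \<cdot> y = Zero T P (Sh T S)"
      using triangle_vanishing(3)[OF t] f SO by (simp add: Hom_iff)
    have "ShM T d' \<cdot> (ShM T p \<cdot> y) = ShM T (d' \<cdot> p) \<cdot> y"
      using d' p(1) y by (simp add: Hom_iff shM_comp_arr)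
    also have "\<dots> = ShM T q \<cdot> (ShM T d \<cdot> y)"
      using q(1) d y by (simp add: qd[symmetric] Hom_iff shM_comp_arr)
    also have "\<dots> = Zero T P (Sh T S')" using dy q(1) PO by (simp add: Hom_iff)
    finally have "ShM T d' \<cdot> (ShM T p \<cdot> y) = Zero T P (Sh T S')" .
    moreover have "ShM T p \<cdot> y \<in> Hom T P (Sh T S')" using p(1) y by (simp add: Hom_iff)
    ultimately obtain z where "z \<in> Hom T P H'" "ShM T p \<cdot> y = w' \<cdot> z"
      using weak_kernel_shift[OF t'] by blast
    then have py: "ShM T p \<cdot> y = Zero T P (Sh T S')"
      using orthD[OF o, of z] g' PO by (simp add: Hom_iff)
    have "y = ShM T (k \<cdot> d \<oplus> j \<cdot> p) \<cdot> y" using y SO by (simp add: kd shM_id Hom_iff)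
    also have "\<dots> = ShM T k \<cdot> (ShM T d \<cdot> y) \<oplus> ShM T j \<cdot> (ShM T p \<cdot> y)"
      using k(1) d j(1) p(1) y by (simp add: Hom_iff shM_comp_arr shM_plus_arr distrib_right)
    also have "\<dots> = Zero T P (Sh T S)" using dy py k(1) j(1) PO by (simp add: Hom_iff)
    finally have "w \<cdot> f = Zero T P (Sh T S)" by (simp add: y_def)
    then obtain x where x: "x \<in> Hom T P S" "f = g \<cdot> x"
      using weak_kernel[OF triangle_rotate[OF t] f] by blast
    have "(g \<cdot> j) \<cdot> d' = (g \<cdot> d) \<cdot> j" using g j(1) d d' jd by (simp add: Hom_iff)
    then have "(g \<cdot> j) \<cdot> d' = Zero T S' H"
      using triangle_vanishing(1)[OF t] j(1) g by (simp add: Hom_iff)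
    then obtain c where c: "c \<in> Hom T H' H" "g \<cdot> j = c \<cdot> g'"
      using weak_cokernel[OF t' comp_Hom[OF j(1) g(1)]] by blast
    have gq0: "g' \<cdot> (q \<cdot> x) = Zero T P H'" using orthD[OF o] g' q(1) x(1) by (auto simp: Hom_iff)
    have "f = g \<cdot> ((d \<cdot> k \<oplus> j \<cdot> q) \<cdot> x)" using x SO by (simp add: dk Hom_iff)
    also have "\<dots> = (g \<cdot> d) \<cdot> (k \<cdot> x) \<oplus> (g \<cdot> j) \<cdot> (q \<cdot> x)"
      using g d k(1) j(1) q(1) x(1) by (simp add: Hom_iff distrib_right distrib_left)
    also have "\<dots> = Zero T S H \<cdot> (k \<cdot> x) \<oplus> c \<cdot> (g' \<cdot> (q \<cdot> x))"
      using triangle_vanishing(1)[OF t] c g' q(1) x(1) by (simp add: Hom_iff)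
    also have "\<dots> = Zero T P H" using gq0 c k(1) x(1) g PO by (simp add: Hom_iff)
    finally show "f = Zero T P H" .
  qed
qed

text \<open>Maps \<open>\<phi> m\<close> from \<open>Y\<close> to the terms of a sequence that are compatible with the transition
  maps give a map from \<open>Y\<close> to the homotopy colimit whose cone is an extension of \<open>E[1]\<close> by \<open>E\<close>, where
  \<open>E\<close> is a coproduct of the cones of the \<open>\<phi> m\<close>. Let \<open>\<psi>\<close> be the coproduct of the \<open>\<phi> m\<close> and let \<open>d0\<close>
  belong to the constant sequence \<open>Y\<close>. The octahedral axiom for the two factorisations
  \<open>\<psi> \<cdot> d0 = d \<cdot> \<psi>\<close> gives maps \<open>Y \<rightarrow> F\<close> and \<open>F \<rightarrow> H\<close>, with \<open>F\<close> a cone of this map, whose cones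
  are \<open>E\<close> and \<open>E[1]\<close>; it is then applied to their composite.\<close>

lemma map_to_hocolim:
  assumes H: "hocolim X s H" and s: "\<And>m. s m \<in> Hom T (X m) (X (Suc m))"
    and \<phi>: "\<And>m. \<phi> m \<in> Hom T Y (X m)" "\<And>m. \<phi> (Suc m) = s m \<cdot> \<phi> m"
    and D: "\<And>m. cone_of (\<phi> m) (D m)"
    and Y: "coproduct T UNIV (\<lambda>_::nat. Y) S0 \<iota>0"
  obtains E \<kappa> f K a b c where "coproduct T UNIV D E \<kappa>" "f \<in> Hom T Y H" "cone_of f K"
    "triangle E K (Sh T E) a b c"
proof -
  obtain S \<iota> d where t: "telescope_map X s S \<iota> d" and cd: "cone_of d H"
    using H unfolding hocolim_def by blast
  then have C: "coproduct T UNIV X S \<iota>" and d: "d \<in> Hom T S S"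
    and di: "\<And>m. d \<cdot> \<iota> m = \<iota> m \<oplus> Neg T (\<iota> (Suc m) \<cdot> s m)"
    unfolding telescope_map_def by blast+
  have SO: "S \<in> Ob T" and i: "\<iota> m \<in> Hom T (X m) S" for m using coproduct_D[OF C] by auto
  have YO: "Y \<in> Ob T" and i0: "\<iota>0 m \<in> Hom T Y S0" for m using coproduct_D[OF Y] by auto
  obtain d0 where t0: "telescope_map (\<lambda>_. Y) (\<lambda>_. Id T Y) S0 \<iota>0 d0"
    using telescope_map_exists[OF Y, of "\<lambda>_. Id T Y"] id_Hom[OF YO] by auto
  then have d0: "d0 \<in> Hom T S0 S0" and di0: "\<And>m. d0 \<cdot> \<iota>0 m = \<iota>0 m \<oplus> Neg T (\<iota>0 (Suc m) \<cdot> Id T Y)"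
    unfolding telescope_map_def by blast+
  obtain \<psi> where \<psi>: "\<psi> \<in> Hom T S0 S" "\<And>m. \<psi> \<cdot> \<iota>0 m = \<iota> m \<cdot> \<phi> m"
    using coproduct_map[OF Y SO, of "\<lambda>m. \<iota> m \<cdot> \<phi> m"] comp_Hom[OF \<phi>(1) i] by auto
  have eq: "\<psi> \<cdot> d0 = d \<cdot> \<psi>"
  proof (rule coproduct_eq[OF Y comp_Hom[OF d0 \<psi>(1)] comp_Hom[OF \<psi>(1) d]])
    fix m
    have "(\<psi> \<cdot> d0) \<cdot> \<iota>0 m = \<psi> \<cdot> \<iota>0 m \<oplus> Neg T (\<psi> \<cdot> \<iota>0 (Suc m))"
      using d0 \<psi>(1) i0[of m] i0[of "Suc m"] by (simp add: di0 Hom_iff distrib_left)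
    also have "\<dots> = (\<iota> m \<oplus> Neg T (\<iota> (Suc m) \<cdot> s m)) \<cdot> \<phi> m"
      using i[of m] i[of "Suc m"] s[of m] \<phi>(1)[of m]
      by (simp add: \<psi>(2) \<phi>(2) Hom_iff distrib_right)
    also have "\<dots> = (d \<cdot> \<psi>) \<cdot> \<iota>0 m"
      using d \<psi>(1) i0[of m] i[of m] \<phi>(1)[of m] by (simp add: \<psi>(2) di[symmetric] Hom_iff)
    finally show "(\<psi> \<cdot> d0) \<cdot> \<iota>0 m = (d \<cdot> \<psi>) \<cdot> \<iota>0 m" .
  qed
  obtain E where E: "cone_of \<psi> E" using cone_of_exists[OF \<psi>(1)] .
  obtain \<kappa> where k: "coproduct T UNIV D E \<kappa>"
    using cone_of_coproduct[OF Y C \<phi>(1) \<psi>(1) \<psi>(2) D E] by blast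
  obtain F where F: "cone_of (d \<cdot> \<psi>) F" using cone_of_exists[OF comp_Hom[OF \<psi>(1) d]] .
  obtain a1 b1 c1 where t1: "triangle Y F E a1 b1 c1"
    using octahedron[OF d0 \<psi>(1) cone_of_constant_telescope[OF t0] E F[folded eq]] .
  obtain a2 b2 c2 where t2: "triangle E F H a2 b2 c2"
    using octahedron[OF \<psi>(1) d E cd F] by blast
  have H1: "a1 \<in> Hom T Y F" "b2 \<in> Hom T F H" using t1 t2 by (auto simp: triangle_def)
  have c1: "cone_of a1 E" using t1 unfolding cone_of_def by blast
  have c2: "cone_of b2 (Sh T E)" using triangle_rotate[OF t2] unfolding cone_of_def by blast
  have fH: "b2 \<cdot> a1 \<in> Hom T Y H" using comp_Hom[OF H1] .
  obtain K where K: "cone_of (b2 \<cdot> a1) K" using cone_of_exists[OF fH] .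
  obtain a b c where "triangle E K (Sh T E) a b c" using octahedron[OF H1 c1 c2 K] .
  then show thesis using that[OF k fH K] by blast
qed

end


section \<open>Small coproducts\<close>

lemma small_bij:
  fixes U :: "'u set" and J :: "'i set"
  assumes "small U J"
  obtains h :: "'i \<Rightarrow> 'u" where "inj_on h J" "small U (h ` J)"
proof -
  have "|J| \<le>o |U|" using assms ordLess_imp_ordLeq unfolding small_def by blast
  then obtain h where h: "inj_on h J" "h ` J \<subseteq> U" using card_of_ordLeq[of J U] by blast
  have "small U (h ` J)"
    using assms card_of_image[of h J] ordLeq_ordLess_trans unfolding small_def by blast
  with h(1) show thesis by (rule that)
qed

context category
begin

lemma coproduct_cong:
  assumes "coproduct T J X C \<iota>" "\<And>j. j \<in> J \<Longrightarrow> X' j = X j"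
  shows "coproduct T J X' C \<iota>"
  using assms unfolding coproduct_def by (simp cong: ball_cong)

lemma small_coproduct_exists:
  fixes U :: "'u set" and J :: "'i set"
  assumes "has_coproducts U T" "small U J" "\<And>j. j \<in> J \<Longrightarrow> X j \<in> Ob T"
  obtains C \<iota> where "coproduct T J X C \<iota>"
proof -
  obtain h :: "'i \<Rightarrow> 'u" where h: "inj_on h J" "small U (h ` J)" by (rule small_bij[OF assms(2)])
  have "\<forall>k\<in>h ` J. (X \<circ> inv_into J h) k \<in> Ob T" using h(1) assms(3) by simp
  then obtain C \<iota> where "coproduct T (h ` J) (X \<circ> inv_into J h) C \<iota>"
    using assms(1) h(2) unfolding has_coproducts_def by blast
  then have "coproduct T J (X \<circ> inv_into J h \<circ> h) C (\<iota> \<circ> h)" using coproduct_reindex h(1) by blast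
  then have "coproduct T J X C (\<iota> \<circ> h)" by (rule coproduct_cong) (use h(1) in simp)
  then show thesis using that by blast
qed

lemma closed_under_small_coproducts:
  fixes U :: "'u set" and J :: "'i set"
  assumes "closed_under_coproducts U T S" "small U J" "\<And>j. j \<in> J \<Longrightarrow> X j \<in> S"
    "coproduct T J X C \<iota>"
  shows "C \<in> S"
proof -
  obtain h :: "'i \<Rightarrow> 'u" where h: "inj_on h J" "small U (h ` J)" by (rule small_bij[OF assms(2)])
  have img: "inv_into J h ` (h ` J) = J" using h(1) by (simp add: image_image)
  have "coproduct T (inv_into J h ` (h ` J)) X C \<iota>" using assms(4) unfolding img .
  then have "coproduct T (h ` J) (X \<circ> inv_into J h) C (\<iota> \<circ> inv_into J h)"
    using coproduct_reindex[OF _ inj_on_inv_into] by blast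
  moreover have "\<forall>k\<in>h ` J. (X \<circ> inv_into J h) k \<in> S" using h(1) assms(3) by simp
  ultimately show ?thesis using assms(1) h(2) unfolding closed_under_coproducts_def by blast
qed

end


section \<open>Partial silting generators are silting\<close>

context triangulated_category
begin

lemma Sh_mem_perp_greaterThan:
  assumes "X \<in> Ob T" "Y \<in> Ob T"
  shows "Sh T Y \<in> perp T X {a<..} \<longleftrightarrow> Y \<in> perp T X {a + 1<..}"
proof -
  have "(\<forall>i>a. orth X (shift T (i + 1) Y)) \<longleftrightarrow> (\<forall>i>a + 1. orth X (shift T i Y))"
    by (metis add_less_cancel_right diff_add_cancel)
  then show ?thesis using assms by (simp add: mem_perp_iff shift_Sh Ball_def)
qed

lemma Sh_mem_perp_atMost:
  assumes "X \<in> Ob T" "Y \<in> Ob T"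
  shows "Sh T Y \<in> perp T X {..a} \<longleftrightarrow> Y \<in> perp T X {..a + 1}"
proof -
  have "(\<forall>i\<le>a. orth X (shift T (i + 1) Y)) \<longleftrightarrow> (\<forall>i\<le>a + 1. orth X (shift T i Y))"
    by (metis add_le_cancel_right diff_add_cancel)
  then show ?thesis using assms by (simp add: mem_perp_iff shift_Sh Ball_def)
qed

lemma perp_antimono: "I \<subseteq> I' \<Longrightarrow> perp T X I' \<subseteq> perp T X I"
  by (auto simp: perp_def)

lemma perp_greaterThan_closed_under_coproducts:
  assumes X: "X \<in> Ob T" and cl: "closed_under_coproducts U T (perp T X {0<..})"
  shows "closed_under_coproducts U T (perp T X {n<..})"
proof (induction n rule: int_induct[where k = 0])
  case base
  then show ?case by (rule cl)
next
  case (step1 i)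
  show ?case unfolding closed_under_coproducts_def
  proof (intro allI impI, elim conjE)
    fix J Y C \<iota> assume J: "small U J" "\<forall>j\<in>J. Y j \<in> perp T X {i + 1<..}" "coproduct T J Y C \<iota>"
    have ob: "C \<in> Ob T" "\<And>j. j \<in> J \<Longrightarrow> Y j \<in> Ob T" using coproduct_D[OF J(3)] by blast+
    have "\<forall>j\<in>J. Sh T (Y j) \<in> perp T X {i<..}" using J(2) ob X by (simp add: Sh_mem_perp_greaterThan)
    then have "Sh T C \<in> perp T X {i<..}"
      using closed_under_small_coproducts[OF step1(2) J(1) _ coproduct_Sh[OF J(3)]] by blast
    then show "C \<in> perp T X {i + 1<..}" using ob X by (simp add: Sh_mem_perp_greaterThan)
  qed
next
  case (step2 i)
  show ?case unfolding closed_under_coproducts_def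
  proof (intro allI impI, elim conjE)
    fix J Y C \<iota> assume J: "small U J" "\<forall>j\<in>J. Y j \<in> perp T X {i - 1<..}" "coproduct T J Y C \<iota>"
    have ob: "C \<in> Ob T" "\<And>j. j \<in> J \<Longrightarrow> Y j \<in> Ob T" using coproduct_D[OF J(3)] by blast+
    obtain C' where C': "C' \<in> Ob T" "Sh T C' = C" using Sh_surj ob(1) by blast
    have "\<exists>Z. Z \<in> Ob T \<and> Sh T Z = Y j" if "j \<in> J" for j using Sh_surj ob(2)[OF that] by metis
    then obtain Y' where Y': "\<And>j. j \<in> J \<Longrightarrow> Y' j \<in> Ob T" "\<And>j. j \<in> J \<Longrightarrow> Sh T (Y' j) = Y j" by metis
    have "coproduct T J (\<lambda>j. Sh T (Y' j)) (Sh T C') \<iota>"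
      unfolding C'(2) by (rule coproduct_cong[OF J(3)]) (simp add: Y'(2))
    then obtain \<iota>' where co: "coproduct T J Y' C' \<iota>'" using coproduct_unSh C'(1) Y'(1) by blast
    have "Y' j \<in> perp T X {i<..}" if "j \<in> J" for j
      using J(2) Y' that Sh_mem_perp_greaterThan[OF X, of "Y' j" "i - 1"] by simp
    then have "C' \<in> perp T X {i<..}"
      using closed_under_small_coproducts[OF step2(2) J(1) _ co] by blast
    then show "C \<in> perp T X {i - 1<..}"
      using Sh_mem_perp_greaterThan[OF X C'(1), of "i - 1"] C'(2) by simp
  qed
qed

text \<open>The \<open>n\<close>-th shift of the class of those objects of \<open>perp T \<tau> {0<..}\<close> that are left
  orthogonal to \<open>perp T \<tau> {..0}\<close>. When \<open>\<tau>\<close> is silting, this is the \<open>n\<close>-th shift of the aisle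
  \<open>perp T \<tau> {0<..}\<close>; before that is known, both conditions are carried along. The shift is built
  into the index sets, which avoids shifting classes of objects.\<close>

definition aisle :: "'a \<Rightarrow> int \<Rightarrow> 'a set" where
  "aisle \<tau> n = {Z \<in> perp T \<tau> {-n<..}. \<forall>B \<in> perp T \<tau> {..-n}. orth Z B}"

lemma aisle_Ob: "Z \<in> aisle \<tau> n \<Longrightarrow> Z \<in> Ob T"
  by (simp add: aisle_def perp_def)

lemma aisle_antimono: "m \<le> n \<Longrightarrow> aisle \<tau> n \<subseteq> aisle \<tau> m"
proof -
  assume "m \<le> n"
  then have "perp T \<tau> {-n<..} \<subseteq> perp T \<tau> {-m<..}" "perp T \<tau> {..-m} \<subseteq> perp T \<tau> {..-n}"
    by (intro perp_antimono; auto)+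
  then show ?thesis unfolding aisle_def by blast
qed

lemma aisle_orth:
  assumes "\<tau> \<in> Ob T" "Z \<in> aisle \<tau> n" "k < n"
  shows "orth (shift T k \<tau>) Z"
proof -
  have "orth \<tau> (shift T (- k) Z)" using assms by (simp add: aisle_def mem_perp_iff)
  then show ?thesis using orth_shift_right[of \<tau> Z "- k"] assms aisle_Ob by simp
qed

lemma aisle_zero: "\<lbrakk>zero_object T Z; \<tau> \<in> Ob T\<rbrakk> \<Longrightarrow> Z \<in> aisle \<tau> n"
proof -
  assume Z: "zero_object T Z" and t: "\<tau> \<in> Ob T"
  have ZO: "Z \<in> Ob T" using Z by (simp add: zero_object_def)
  have "orth \<tau> (shift T i Z)" for i
    using zero_object_orth(2)[OF Z, of "shift T (- i) \<tau>"] t ZO by (simp add: orth_shift_right)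
  moreover have "orth Z B" if "B \<in> perp T \<tau> {..-n}" for B
    using that zero_object_orth(1)[OF Z] by (simp add: perp_def)
  ultimately show ?thesis using t ZO by (simp add: aisle_def mem_perp_iff)
qed

lemma Sh_mem_aisle:
  assumes t: "\<tau> \<in> Ob T" and Z: "Z \<in> Ob T"
  shows "Sh T Z \<in> aisle \<tau> (n + 1) \<longleftrightarrow> Z \<in> aisle \<tau> n"
proof -
  have "(\<forall>B \<in> perp T \<tau> {..-(n + 1)}. orth (Sh T Z) B) \<longleftrightarrow> (\<forall>B \<in> perp T \<tau> {..-n}. orth Z B)"
  proof
    assume L: "\<forall>B \<in> perp T \<tau> {..-(n + 1)}. orth (Sh T Z) B"
    show "\<forall>B \<in> perp T \<tau> {..-n}. orth Z B"
    proof
      fix B assume B: "B \<in> perp T \<tau> {..-n}"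
      then have BO: "B \<in> Ob T" by (simp add: perp_def)
      then have "Sh T B \<in> perp T \<tau> {..-(n + 1)}" using Sh_mem_perp_atMost[OF t BO] B by simp
      then show "orth Z B" using L orth_Sh_iff Z BO by blast
    qed
  next
    assume R: "\<forall>B \<in> perp T \<tau> {..-n}. orth Z B"
    show "\<forall>B \<in> perp T \<tau> {..-(n + 1)}. orth (Sh T Z) B"
    proof
      fix B assume B: "B \<in> perp T \<tau> {..-(n + 1)}"
      then have "B \<in> Ob T" by (simp add: perp_def)
      then obtain B' where B': "B' \<in> Ob T" "Sh T B' = B" using Sh_surj by blast
      then have "B' \<in> perp T \<tau> {..-n}" using Sh_mem_perp_atMost[OF t B'(1), of "-(n + 1)"] B by simp
      then show "orth (Sh T Z) B" using R orth_Sh_iff Z B' by blast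
    qed
  qed
  moreover have "Sh T Z \<in> perp T \<tau> {-(n + 1)<..} \<longleftrightarrow> Z \<in> perp T \<tau> {-n<..}"
    using Sh_mem_perp_greaterThan[OF t Z, of "-(n + 1)"] by simp
  ultimately show ?thesis by (simp only: aisle_def mem_Collect_eq)
qed

lemma aisle_extension:
  assumes "\<tau> \<in> Ob T" "triangle A B C u v w" "A \<in> aisle \<tau> n" "C \<in> aisle \<tau> n"
  shows "B \<in> aisle \<tau> n"
  using perp_extension[OF assms(1,2)] orth_middle_left[OF assms(2)] assms(3,4)
  unfolding aisle_def by blast

lemma shift_generator_mem_aisle:
  assumes "\<tau> \<in> Ob T" "\<tau> \<in> perp T \<tau> {0<..}"
  shows "shift T (int n) \<tau> \<in> aisle \<tau> (int n)"
proof (induction n)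
  case 0
  have "orth \<tau> B" if "B \<in> perp T \<tau> {..0}" for B
    using that assms(1) by (auto simp: mem_perp_iff dest: bspec[of _ _ 0])
  then show ?case using assms by (simp add: aisle_def)
next
  case (Suc n)
  then have "Sh T (shift T (int n) \<tau>) \<in> aisle \<tau> (int n + 1)"
    using Sh_mem_aisle[OF assms(1), of "shift T (int n) \<tau>"] assms(1) by simp
  then show ?case using assms(1) by (simp add: Sh_shift add.commute)
qed

lemma aisle_coproduct:
  fixes U :: "'u set" and J :: "'i set"
  assumes "\<tau> \<in> Ob T" "closed_under_coproducts U T (perp T \<tau> {0<..})" "small U J"
    "\<And>j. j \<in> J \<Longrightarrow> X j \<in> aisle \<tau> n" "coproduct T J X C \<iota>"
  shows "C \<in> aisle \<tau> n"
proof -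
  have "C \<in> perp T \<tau> {-n<..}"
    by (rule closed_under_small_coproducts[OF perp_greaterThan_closed_under_coproducts[OF assms(1,2)]
          assms(3) _ assms(5)]) (use assms(4) in \<open>simp add: aisle_def\<close>)
  moreover have "orth C B" if "B \<in> perp T \<tau> {..-n}" for B
    by (rule orth_coproduct[OF assms(5)]) (use assms(4) that in \<open>simp add: aisle_def\<close>)
  ultimately show ?thesis by (simp add: aisle_def)
qed

text \<open>The cone of the canonical map to \<open>X\<close> from a copower \<open>A\<close> of \<open>\<tau>[n]\<close>, indexed by all maps
  \<open>\<tau>[n] \<rightarrow> X\<close>, receives no nonzero map from \<open>\<tau>[n]\<close>: those coming from \<open>X\<close> are killed, and there
  are no others because \<open>Hom(\<tau>[n], A[1])\<close> vanishes. The latter holds as \<open>perp T \<tau> {0<..}\<close>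
  contains \<open>\<tau>\<close> and is closed under coproducts; no compactness of \<open>\<tau>\<close> is needed.\<close>

lemma kill_maps:
  fixes U :: "'u set"
  assumes hc: "has_coproducts U T"
    and sm: "\<And>X Y. \<lbrakk>X \<in> Ob T; Y \<in> Ob T\<rbrakk> \<Longrightarrow> small U (Hom T X Y)"
    and t: "\<tau> \<in> Ob T" "\<tau> \<in> perp T \<tau> {0<..}" "closed_under_coproducts U T (perp T \<tau> {0<..})"
    and X: "X \<in> Ob T"
  obtains X' s C where "s \<in> Hom T X X'" "cone_of s C" "C \<in> aisle \<tau> (int n + 1)"
    "orth (shift T (int n) \<tau>) X'"
proof -
  define P where "P = shift T (int n) \<tau>"
  have P: "P \<in> Ob T" "P \<in> aisle \<tau> (int n)"
    using t shift_generator_mem_aisle by (auto simp: P_def)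
  have small: "small U (Hom T P X)" using sm P X by blast
  obtain A \<iota> where A: "coproduct T (Hom T P X) (\<lambda>_. P) A \<iota>"
    using small_coproduct_exists[OF hc small, of "\<lambda>_. P"] P by blast
  have AL: "A \<in> aisle \<tau> (int n)" using aisle_coproduct[OF t(1,3) small _ A] P by blast
  then have AO: "A \<in> Ob T" using aisle_Ob by blast
  obtain u where u: "u \<in> Hom T A X" "\<And>f. f \<in> Hom T P X \<Longrightarrow> u \<cdot> \<iota> f = f"
    using coproduct_map[OF A X, of "\<lambda>f. f"] by blast
  obtain X' s w where tr: "triangle A X X' u s w" using triangle_exists[OF u(1)] .
  then have m: "s \<in> Hom T X X'" "X' \<in> Ob T" by (auto simp: triangle_def Hom_iff)
  have c: "cone_of s (Sh T A)" using triangle_rotate[OF tr] unfolding cone_of_def by blast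
  have SA: "Sh T A \<in> aisle \<tau> (int n + 1)" using Sh_mem_aisle[OF t(1) AO] AL by blast
  have "orth P X'"
  proof (rule orthI)
    fix f assume f: "f \<in> Hom T P X'"
    have "w \<cdot> f \<in> Hom T P (Sh T A)" using f tr comp_Hom unfolding triangle_def by blast
    moreover have "orth P (Sh T A)" using aisle_orth[OF t(1) SA, of "int n"] by (simp add: P_def)
    ultimately have "w \<cdot> f = Zero T P (Sh T A)" by (intro orthD)
    then obtain g where g: "g \<in> Hom T P X" "f = s \<cdot> g"
      using weak_kernel[OF triangle_rotate[OF tr] f] by blast
    have i: "\<iota> g \<in> Hom T P A" using coproduct_D(3)[OF A g(1)] .
    have "f = s \<cdot> (u \<cdot> \<iota> g)" using g u(2) by simp
    also have "\<dots> = (s \<cdot> u) \<cdot> \<iota> g" using u(1) m i by (simp add: Hom_iff)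
    also have "\<dots> = Zero T P X'" using triangle_vanishing(1)[OF tr] i m by (simp add: Hom_iff)
    finally show "f = Zero T P X'" .
  qed
  then show thesis using that m(1) c SA unfolding P_def by blast
qed

text \<open>Killing the maps from \<open>\<tau>, \<tau>[1], \<tau>[2], \<dots>\<close> in turn yields a sequence whose homotopy colimit is
  the truncation of \<open>Z\<close>. The maps from \<open>\<tau>[k]\<close> are compared with those into the tail of the sequence that
  starts right after they have been killed.\<close>

proposition truncation_triangle:
  fixes U :: "'u set"
  assumes hc: "has_coproducts U T"
    and sm: "\<And>X Y. \<lbrakk>X \<in> Ob T; Y \<in> Ob T\<rbrakk> \<Longrightarrow> small U (Hom T X Y)"
    and inf: "natLeq <o |U|"
    and t: "\<tau> \<in> Ob T" "\<tau> \<in> perp T \<tau> {0<..}" "closed_under_coproducts U T (perp T \<tau> {0<..})"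
    and Z: "Z \<in> Ob T"
  obtains A B u v w where "triangle A Z B u v w" "A \<in> aisle \<tau> 0" "B \<in> perp T \<tau> {..0}"
proof -
  have small_nat: "small U (UNIV :: nat set)"
    using inf card_of_nat ordIso_ordLess_trans unfolding small_def by blast
  define Q where "Q = (\<lambda>n X s X'. s \<in> Hom T X X' \<and> (\<exists>C. cone_of s C \<and> C \<in> aisle \<tau> (int n + 1)) \<and>
      orth (shift T (int n) \<tau>) X')"
  have "\<exists>X' s. Q n X s X'" if "X \<in> Ob T" for n X
    using kill_maps[OF hc sm t that, of n] unfolding Q_def by metis
  then have "\<exists>X'. (X' \<in> Ob T \<and> (Suc n = 0 \<longrightarrow> X' = Z)) \<and> (\<exists>s. Q n X s X')"
    if "X \<in> Ob T \<and> (n = 0 \<longrightarrow> X = Z)" for n X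
    using that unfolding Q_def Hom_iff by (metis nat.distinct(2))
  then obtain X where X0: "\<And>n. X n \<in> Ob T \<and> (n = 0 \<longrightarrow> X n = Z)" and "\<And>n. \<exists>s. Q n (X n) s (X (Suc n))"
    using dependent_nat_choice[of "\<lambda>n X. X \<in> Ob T \<and> (n = 0 \<longrightarrow> X = Z)" "\<lambda>n X X'. \<exists>s. Q n X s X'"] Z
    by metis
  then obtain s where sQ: "\<And>n. Q n (X n) (s n) (X (Suc n))" by metis
  have X: "X n \<in> Ob T" "X 0 = Z" for n using X0 by auto
  have s: "s n \<in> Hom T (X n) (X (Suc n))" and os: "orth (shift T (int n) \<tau>) (X (Suc n))" for n
    using sQ[of n] by (auto simp: Q_def)
  obtain C where C: "\<And>n. cone_of (s n) (C n)" "\<And>n. C n \<in> aisle \<tau> (int n + 1)"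
    using sQ unfolding Q_def by metis
  have "\<exists>H. hocolim (\<lambda>m. X (N + m)) (\<lambda>m. s (N + m)) H" for N
  proof -
    obtain S \<iota> where S: "coproduct T UNIV (\<lambda>m. X (N + m)) S \<iota>"
      using small_coproduct_exists[OF hc small_nat, of "\<lambda>m. X (N + m)"] X by blast
    obtain d where d: "telescope_map (\<lambda>m. X (N + m)) (\<lambda>m. s (N + m)) S \<iota> d"
      using telescope_map_exists[OF S] s by (metis add_Suc_right)
    then have "d \<in> Hom T S S" unfolding telescope_map_def by blast
    then obtain H where "cone_of d H" using cone_of_exists by blast
    then show ?thesis using d unfolding hocolim_def by blast
  qed
  then obtain H where H: "\<And>N. hocolim (\<lambda>m. X (N + m)) (\<lambda>m. s (N + m)) (H N)" by metis
  \<comment> \<open>All cones of the maps \<open>X N \<rightarrow> X (N + m)\<close> lie in the shifted aisle, hence so does a cone of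
    \<open>X N \<rightarrow> H N\<close>.\<close>
  have key: "\<exists>f K. f \<in> Hom T (X N) (H N) \<and> cone_of f K \<and> K \<in> aisle \<tau> (int N + 1)" for N
  proof -
    define \<phi> where "\<phi> = rec_nat (Id T (X N)) (\<lambda>m x. s (N + m) \<cdot> x)"
    have p0: "\<phi> 0 = Id T (X N)" and pS: "\<phi> (Suc m) = s (N + m) \<cdot> \<phi> m" for m
      by (simp_all add: \<phi>_def)
    have p: "\<phi> m \<in> Hom T (X N) (X (N + m))" for m
    proof (induction m)
      case 0
      then show ?case using id_Hom[OF X(1)] by (simp add: p0)
    next
      case (Suc m)
      then show ?case using comp_Hom[OF Suc s[of "N + m"]] by (simp add: pS)
    qed
    have "\<exists>D. cone_of (\<phi> m) D \<and> D \<in> aisle \<tau> (int N + 1)" for m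
    proof (induction m)
      case 0
      obtain D where "cone_of (Id T (X N)) D" "zero_object T D" using cone_of_Id[OF X(1)] .
      then show ?case using aisle_zero t(1) unfolding p0 by blast
    next
      case (Suc m)
      then obtain D where D: "cone_of (\<phi> m) D" "D \<in> aisle \<tau> (int N + 1)" by blast
      obtain F where F: "cone_of (s (N + m) \<cdot> \<phi> m) F" using cone_of_exists[OF comp_Hom[OF p s]] .
      obtain a b c where tr: "triangle D F (C (N + m)) a b c"
        using octahedron[OF p s D(1) C(1) F] .
      have "C (N + m) \<in> aisle \<tau> (int N + 1)"
        using C(2)[of "N + m"] aisle_antimono[of "int N + 1" "int (N + m) + 1" \<tau>] by auto
      then have "F \<in> aisle \<tau> (int N + 1)" using aisle_extension[OF t(1) tr D(2)] by blast
      then show ?case using F unfolding pS by blast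
    qed
    then obtain D where D: "\<And>m. cone_of (\<phi> m) (D m)" "\<And>m. D m \<in> aisle \<tau> (int N + 1)" by metis
    obtain S0 \<iota>0 where S0: "coproduct T UNIV (\<lambda>_::nat. X N) S0 \<iota>0"
      using small_coproduct_exists[OF hc small_nat, of "\<lambda>_. X N"] X by blast
    have sN: "s (N + m) \<in> Hom T (X (N + m)) (X (N + Suc m))" for m using s[of "N + m"] by simp
    obtain E \<kappa> f K a b c where E: "coproduct T UNIV D E \<kappa>" and f: "f \<in> Hom T (X N) (H N)" "cone_of f K"
      and tr: "triangle E K (Sh T E) a b c"
      using map_to_hocolim[OF H[of N] sN p pS D(1) S0] by blast
    have EL: "E \<in> aisle \<tau> (int N + 1)" using aisle_coproduct[OF t(1,3) small_nat D(2) E] .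
    then have "Sh T E \<in> aisle \<tau> (int N + 1 + 1)" using Sh_mem_aisle[OF t(1)] aisle_Ob by blast
    then have "Sh T E \<in> aisle \<tau> (int N + 1)"
      using aisle_antimono[of "int N + 1" "int N + 1 + 1" \<tau>] by auto
    then have "K \<in> aisle \<tau> (int N + 1)" using aisle_extension[OF t(1) tr EL] by blast
    then show ?thesis using f by blast
  qed
  have tail: "orth P (H 0)" if "orth P (H N)" for P N
    using that
  proof (induction N)
    case (Suc N)
    have sN: "s (N + m) \<in> Hom T (X (N + m)) (X (N + Suc m))" for m using s[of "N + m"] by simp
    have H': "hocolim (\<lambda>m. X (N + Suc m)) (\<lambda>m. s (N + Suc m)) (H (Suc N))" using H[of "Suc N"] by simp
    have "orth P (H N)" using orth_hocolim_tail[OF H[of N] H' sN Suc.prems] .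
    then show ?case by (rule Suc.IH)
  qed
  have HO: "H N \<in> Ob T" for N using key[of N] by (auto simp: Hom_iff)
  have "orth \<tau> (shift T i (H 0))" if "i \<le> 0" for i
  proof -
    define k where "k = nat (- i)"
    have i: "- i = int k" using that by (simp add: k_def)
    obtain f K where f: "f \<in> Hom T (X (Suc k)) (H (Suc k))" "cone_of f K" "K \<in> aisle \<tau> (int (Suc k) + 1)"
      using key[of "Suc k"] by blast
    obtain v w where tr: "triangle (X (Suc k)) (H (Suc k)) K f v w" using cone_ofD[OF f(2,1)] .
    have "orth (shift T (int k) \<tau>) (H (Suc k))"
      using orth_middle_right[OF tr os[of k]] aisle_orth[OF t(1) f(3), of "int k"] by simp
    then have "orth (shift T (- i) \<tau>) (H 0)" unfolding i by (rule tail)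
    then show ?thesis using orth_shift_right t(1) HO by blast
  qed
  then have W: "H 0 \<in> perp T \<tau> {..0}" using t(1) HO by (simp add: mem_perp_iff)
  obtain f K where f: "f \<in> Hom T Z (H 0)" "cone_of f K" "K \<in> aisle \<tau> (0 + 1)"
    using key[of 0] X(2) by auto
  obtain A where A: "A \<in> Ob T" "Sh T A = K" using Sh_surj aisle_Ob[OF f(3)] by blast
  obtain v w where "triangle Z (H 0) (Sh T A) f v w" using cone_ofD[OF f(2,1)] A(2) by blast
  then obtain u where u: "triangle A Z (H 0) u f v" using triangle_rotate_back A(1) by blast
  have "A \<in> aisle \<tau> 0" using Sh_mem_aisle[OF t(1) A(1)] f(3) A(2) by blast
  then show thesis using that[OF u] W by blast
qed

text \<open>A presilting object \<open>\<tau>\<close> that generates and whose class \<open>perp T \<tau> {0<..}\<close> is closed under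
  coproducts is silting. The truncation triangles of the previous proposition have their first term
  in \<open>aisle \<tau> 0\<close>; for an object of \<open>perp T \<tau> {0<..}\<close> the third term lies in
  \<open>perp T \<tau> UNIV\<close>, hence is zero, so that \<open>perp T \<tau> {0<..}\<close> is contained in \<open>aisle \<tau> 0\<close>.\<close>

theorem silting_criterion:
  fixes U :: "'u set"
  assumes hc: "has_coproducts U T"
    and sm: "\<And>X Y. \<lbrakk>X \<in> Ob T; Y \<in> Ob T\<rbrakk> \<Longrightarrow> small U (Hom T X Y)"
    and inf: "natLeq <o |U|"
    and t: "\<tau> \<in> Ob T" "\<tau> \<in> perp T \<tau> {0<..}" "closed_under_coproducts U T (perp T \<tau> {0<..})"
    and gen: "\<And>Y. Y \<in> perp T \<tau> UNIV \<Longrightarrow> zero_object T Y"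
  shows "silting T \<tau>"
proof -
  let ?V = "perp T \<tau> {0<..}" and ?W = "perp T \<tau> {..0}"
  have VO: "?V \<subseteq> Ob T" and WO: "?W \<subseteq> Ob T" by (auto simp: perp_def)
  have shV: "shift T n Y \<in> ?V" if "Y \<in> ?V" "n > 0" for Y n
    using that t(1) by (auto simp: mem_perp_iff shift_shift)
  have V: "Y \<in> aisle \<tau> 0" if Y: "Y \<in> ?V" for Y
  proof -
    have YO: "Y \<in> Ob T" using Y VO by blast
    obtain A B u v w where tr: "triangle A Y B u v w" and A: "A \<in> aisle \<tau> 0" and B: "B \<in> ?W"
      using truncation_triangle[OF hc sm inf t YO] .
    have "A \<in> ?V" using A by (simp add: aisle_def)
    then have "Sh T A \<in> ?V" using shV[of A 1] VO by auto
    then have "B \<in> ?V" using perp_extension[OF t(1) triangle_rotate[OF tr] Y] by blast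
    moreover have "i \<in> {0<..} \<or> i \<in> {..0}" for i :: int by auto
    ultimately have "B \<in> perp T \<tau> UNIV" using B unfolding mem_perp_iff[OF t(1)] by blast
    then have "zero_object T B" by (rule gen)
    then show ?thesis using aisle_extension[OF t(1) tr A] aisle_zero t(1) by blast
  qed
  have "torsion_pair T ?V ?W" unfolding torsion_pair_def
  proof (intro conjI ballI)
    show "closed_under_summands T ?V" "closed_under_summands T ?W"
      using perp_closed_under_summands t(1) by blast+
    show "Hom T A B = {Zero T A B}" if "A \<in> ?V" "B \<in> ?W" for A B
    proof -
      have "orth A B" using V[OF that(1)] that(2) by (simp add: aisle_def)
      then show ?thesis using Hom_eq_Zero_iff that VO WO by blast
    qed
    fix Y assume "Y \<in> Ob T"
    then obtain A B u v w where tr: "triangle A Y B u v w" "A \<in> aisle \<tau> 0" "B \<in> ?W"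
      using truncation_triangle[OF hc sm inf t] by blast
    moreover have "A \<in> ?V" using tr(2) by (simp add: aisle_def)
    moreover have "shift T 1 A = Sh T A" using aisle_Ob[OF tr(2)] by simp
    ultimately show "\<exists>A\<in>?V. \<exists>B\<in>?W. \<exists>u\<in>Hom T A Y. \<exists>v\<in>Hom T Y B. \<exists>w\<in>Hom T B (shift T 1 A).
        (u, v, w) \<in> Tri T"
      unfolding triangle_def by metis
  qed (use VO WO in blast)+
  moreover have "Cod T u \<in> ?V"
    if tri: "(u, v, w) \<in> Tri T" and V2: "Dom T u \<in> ?V" "Cod T v \<in> ?V" for u v w
  proof -
    obtain X Y Z where h: "u \<in> Hom T X Y" "v \<in> Hom T Y Z" "w \<in> Hom T Z (Sh T X)"
      using tri_typed[OF tri] by blast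
    then have tr: "triangle X Y Z u v w" using tri unfolding triangle_def by blast
    have "X \<in> ?V" "Z \<in> ?V" using V2 h by (auto simp: Hom_iff)
    then have "Y \<in> ?V" using perp_extension[OF t(1) tr] by blast
    then show ?thesis using h by (simp add: Hom_iff)
  qed
  ultimately show ?thesis using t(1) shV unfolding silting_def t_structure_def by blast
qed

end


section \<open>Silting in a triangulated subcategory\<close>

context triangulated_category
begin

text \<open>Negative shifts in a full subcategory are formed with the inverse of the shift on its own
  class of objects; they agree with those of the ambient category as soon as membership in the class
  is invariant under the shift.\<close>

lemma shift_full_sub:
  assumes S: "S \<subseteq> Ob T" "\<forall>X \<in> Ob T. Sh T X \<in> S \<longleftrightarrow> X \<in> S" and X: "X \<in> S"
  shows "shift (full_sub T S) n X = shift T n X"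
proof -
  have Sh: "Sh (full_sub T S) = Sh T" and Ob: "Ob (full_sub T S) = S"
    by (simp_all add: full_sub_def Let_def)
  have inv: "inv_into S (Sh T) Z = inv_into (Ob T) (Sh T) Z \<and> inv_into S (Sh T) Z \<in> S" if Z: "Z \<in> S" for Z
  proof -
    obtain W where W: "W \<in> Ob T" "Sh T W = Z" using Sh_surj S(1) Z by blast
    then have WS: "W \<in> S" using S(2) Z by blast
    have i: "inj_on (Sh T) (Ob T)" using sh_bij by (simp add: bij_betw_def)
    then have "inv_into (Ob T) (Sh T) Z = W" using W inv_into_f_eq by metis
    moreover have "inv_into S (Sh T) Z = W"
      using W WS inv_into_f_eq[OF inj_on_subset[OF i S(1)]] by blast
    ultimately show ?thesis using WS by simp
  qed
  have "(inv_into S (Sh T) ^^ k) X = (inv_into (Ob T) (Sh T) ^^ k) X \<and> (inv_into S (Sh T) ^^ k) X \<in> S" for k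
  proof (induction k)
    case (Suc k)
    then have "(inv_into (Ob T) (Sh T) ^^ k) X \<in> S" by metis
    then show ?case using Suc inv by (metis comp_apply funpow.simps(2))
  qed (use X in simp)
  then show ?thesis by (simp add: shift_def Sh Ob)
qed

lemma Hom_full_sub: "\<lbrakk>X \<in> S; Y \<in> S\<rbrakk> \<Longrightarrow> Hom (full_sub T S) X Y = Hom T X Y"
  by (auto simp: Hom_def full_sub_def Let_def)

lemma perp_full_sub:
  assumes S: "S \<subseteq> Ob T" "\<forall>X \<in> Ob T. Sh T X \<in> S \<longleftrightarrow> X \<in> S" and X: "X \<in> S"
  shows "perp (full_sub T S) X I = S \<inter> perp T X I"
proof -
  have Z: "Zero (full_sub T S) = Zero T" and Ob: "Ob (full_sub T S) = S"
    by (simp_all add: full_sub_def Let_def)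
  have sh: "shift T n Y \<in> S \<longleftrightarrow> Y \<in> S" if "Y \<in> Ob T" for n Y
  proof (induction n rule: int_induct[where k = 0])
    case (step1 i)
    then show ?case using S(2)[rule_format, of "shift T i Y"] that by (simp add: Sh_shift)
  next
    case (step2 i)
    then show ?case using S(2)[rule_format, of "shift T (i - 1) Y"] that by (simp add: Sh_shift)
  qed simp
  have H: "Hom (full_sub T S) X (shift T i Y) = Hom T X (shift T i Y)" if "Y \<in> S" for i Y
    using Hom_full_sub[OF X, of "shift T i Y"] sh that S(1) by auto
  show ?thesis
  proof (rule set_eqI)
    fix Y
    show "Y \<in> perp (full_sub T S) X I \<longleftrightarrow> Y \<in> S \<inter> perp T X I"
    proof (cases "Y \<in> S")
      case True
      then have "Y \<in> Ob T" using S(1) by blast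
      with True show ?thesis by (simp add: perp_def Ob Z shift_full_sub[OF S True] H)
    qed (simp add: perp_def Ob)
  qed
qed

lemma silting_full_sub_truncation:
  assumes S: "S \<subseteq> Ob T" "\<forall>X \<in> Ob T. Sh T X \<in> S \<longleftrightarrow> X \<in> S"
    and \<sigma>: "silting (full_sub T S) \<sigma>" and Z: "Z \<in> S"
  obtains A B u v w where "triangle A Z B u v w" "A \<in> S" "A \<in> perp T \<sigma> {0<..}"
    "B \<in> S" "B \<in> perp T \<sigma> {..0}"
proof -
  have Ob: "Ob (full_sub T S) = S" and Tri: "Tri (full_sub T S) \<subseteq> Tri T"
    by (auto simp: full_sub_def Let_def)
  have \<sigma>S: "\<sigma> \<in> S" using \<sigma> by (simp add: silting_def Ob)
  have "\<exists>A \<in> S \<inter> perp T \<sigma> {0<..}. \<exists>B \<in> S \<inter> perp T \<sigma> {..0}. \<exists>u \<in> Hom (full_sub T S) A Z.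
      \<exists>v \<in> Hom (full_sub T S) Z B. \<exists>w \<in> Hom (full_sub T S) B (shift (full_sub T S) 1 A).
      (u, v, w) \<in> Tri (full_sub T S)"
    using \<sigma> Z unfolding silting_def t_structure_def torsion_pair_def Ob perp_full_sub[OF S \<sigma>S] by blast
  then obtain A B u v w where A: "A \<in> S" "A \<in> perp T \<sigma> {0<..}" and B: "B \<in> S" "B \<in> perp T \<sigma> {..0}"
    and m: "u \<in> Hom (full_sub T S) A Z" "v \<in> Hom (full_sub T S) Z B"
    "w \<in> Hom (full_sub T S) B (shift (full_sub T S) 1 A)" "(u, v, w) \<in> Tri (full_sub T S)"
    by blast
  have "shift (full_sub T S) 1 A = Sh T A" using shift_full_sub[OF S A(1)] A(1) S(1) by auto
  moreover have "Sh T A \<in> S" using S A(1) by blast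
  ultimately have "triangle A Z B u v w"
    using m Tri Hom_full_sub A(1) B(1) Z unfolding triangle_def by auto
  then show thesis using that A B by blast
qed

text \<open>For \<open>\<sigma>\<close> silting in a shift-closed full subcategory, an object of it without nonzero maps to
  \<open>perp T \<sigma> {..0}\<close> is a retract of its truncation, hence lies in \<open>perp T \<sigma> {0<..}\<close>. This
  applies to \<open>\<sigma>\<close> itself and to those copowers of \<open>\<sigma>\<close> that lie in the subcategory.\<close>

lemma silting_full_sub_left_orth:
  assumes S: "S \<subseteq> Ob T" "\<forall>X \<in> Ob T. Sh T X \<in> S \<longleftrightarrow> X \<in> S"
    and \<sigma>: "silting (full_sub T S) \<sigma>" and Z: "Z \<in> S"
    and o: "\<And>B. B \<in> perp T \<sigma> {..0} \<Longrightarrow> orth Z B"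
  shows "Z \<in> perp T \<sigma> {0<..}"
proof -
  have \<sigma>O: "\<sigma> \<in> Ob T" using \<sigma> S(1) by (auto simp: silting_def full_sub_def Let_def)
  obtain A B u v w where tr: "triangle A Z B u v w" and A: "A \<in> perp T \<sigma> {0<..}"
    and B: "B \<in> perp T \<sigma> {..0}"
    using silting_full_sub_truncation[OF S \<sigma> Z] by metis
  have u: "u \<in> Hom T A Z" "v \<in> Hom T Z B" "A \<in> Ob T" "Z \<in> Ob T"
    using tr by (auto simp: triangle_def Hom_iff)
  have "v = Zero T Z B" using o[OF B] u(2) by (rule orthD)
  then have "v \<cdot> Id T Z = Zero T Z B" using u by (simp add: Hom_iff)
  then obtain t where t: "t \<in> Hom T Z A" "Id T Z = u \<cdot> t"
    using weak_kernel[OF tr id_Hom[OF u(4)]] by blast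
  have "orth \<sigma> (shift T i Z)" if "i > 0" for i
  proof -
    have "orth (shift T (- i) \<sigma>) A"
      using A that \<sigma>O u(3) by (simp add: mem_perp_iff orth_shift_right)
    then have "orth (shift T (- i) \<sigma>) Z" using orth_retract_right[OF _ u(1) t(1) t(2)[symmetric]] by blast
    then show ?thesis using \<sigma>O u(4) by (simp add: orth_shift_right)
  qed
  then show ?thesis using \<sigma>O u(4) by (simp add: mem_perp_iff)
qed

lemma silting_full_sub_generates:
  assumes S: "S \<subseteq> Ob T" "\<forall>X \<in> Ob T. Sh T X \<in> S \<longleftrightarrow> X \<in> S"
    and \<sigma>: "silting (full_sub T S) \<sigma>" and Z: "Z \<in> S" "Z \<in> perp T \<sigma> UNIV"
  shows "zero_object T Z"
proof -
  have Ob: "Ob (full_sub T S) = S" and Ze: "Zero (full_sub T S) = Zero T"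
    by (simp_all add: full_sub_def Let_def)
  have \<sigma>S: "\<sigma> \<in> S" using \<sigma> by (simp add: silting_def Ob)
  have "Z \<in> S \<inter> perp T \<sigma> {0<..}" "Z \<in> S \<inter> perp T \<sigma> {..0}"
    using Z perp_antimono[of "{0<..}" UNIV] perp_antimono[of "{..0}" UNIV] by blast+
  then have "Hom (full_sub T S) Z Z = {Zero T Z Z}"
    using \<sigma> unfolding silting_def t_structure_def torsion_pair_def perp_full_sub[OF S \<sigma>S] Ze by blast
  then have "orth Z Z" using Hom_full_sub[OF Z(1) Z(1)] unfolding orth_def by blast
  then show ?thesis using zero_objectI Z(1) S(1) by blast
qed


section \<open>Gluing silting objects\<close>

text \<open>The gluing construction inside the ambient category, in which \<open>perp T \<omega> UNIV\<close> is a full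
  subcategory closed under shifts and coproducts.\<close>

theorem silting_gluing:
  fixes U :: "'u set"
  assumes hc: "has_coproducts U T"
    and sm: "\<And>X Y. \<lbrakk>X \<in> Ob T; Y \<in> Ob T\<rbrakk> \<Longrightarrow> small U (Hom T X Y)"
    and inf: "natLeq <o |U|"
    and ps: "partial_silting U T \<omega>"
    and \<sigma>: "silting (full_sub T (perp T \<omega> UNIV)) \<sigma>"
    and cl: "closed_under_coproducts U T (perp T \<sigma> {0<..} \<inter> perp T \<omega> {0<..})"
    and ext: "\<And>k. k \<ge> 2 \<Longrightarrow> orth \<sigma> (shift T k \<omega>)"
    and C: "coproduct T (Hom T \<sigma> (Sh T \<omega>)) (\<lambda>_. \<sigma>) \<sigma>I \<iota>"
    and \<alpha>: "\<And>f. f \<in> Hom T \<sigma> (Sh T \<omega>) \<Longrightarrow> \<alpha> \<cdot> \<iota> f = f"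
    and tr: "triangle \<omega> \<sigma>' \<sigma>I a b \<alpha>"
    and ds: "direct_sum T \<sigma>' \<sigma> \<tau>"
  shows "silting T \<tau>"
proof -
  define S where "S = perp T \<omega> UNIV"
  have \<omega>V: "\<omega> \<in> perp T \<omega> {0<..}" and \<omega>cl: "closed_under_coproducts U T (perp T \<omega> {0<..})"
    using ps by (auto simp: partial_silting_def)
  then have \<omega>: "\<omega> \<in> Ob T" by (simp add: perp_def)
  have SO: "S \<subseteq> Ob T" by (auto simp: S_def perp_def)
  have memS: "Y \<in> S \<longleftrightarrow> Y \<in> Ob T \<and> (\<forall>i. orth \<omega> (shift T i Y))" for Y
    using \<omega> by (simp add: S_def mem_perp_iff)
  have SSh: "\<forall>Y \<in> Ob T. Sh T Y \<in> S \<longleftrightarrow> Y \<in> S"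
  proof
    fix Y assume Y: "Y \<in> Ob T"
    have "(\<forall>i. orth \<omega> (shift T (i + 1) Y)) \<longleftrightarrow> (\<forall>i. orth \<omega> (shift T i Y))"
      by (metis diff_add_cancel)
    then show "Sh T Y \<in> S \<longleftrightarrow> Y \<in> S" using Y by (simp add: memS shift_Sh)
  qed
  note S = SO SSh
  have \<sigma>S': "silting (full_sub T S) \<sigma>" using \<sigma> by (simp add: S_def)
  have \<sigma>S: "\<sigma> \<in> S" using \<sigma>S' by (simp add: silting_def full_sub_def Let_def)
  then have \<sigma>O: "\<sigma> \<in> Ob T" using SO by blast
  have small: "small U (Hom T \<sigma> (Sh T \<omega>))" using sm \<sigma>O \<omega> by simp
  have \<sigma>IO: "\<sigma>I \<in> Ob T" and \<sigma>'O: "\<sigma>' \<in> Ob T" using tr by (auto simp: triangle_def Hom_iff)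
  have \<tau>O: "\<tau> \<in> Ob T" using ds by (simp add: direct_sum_def)
  have \<sigma>W: "orth \<sigma> B" if "B \<in> perp T \<sigma> {..0}" for B
    using that \<sigma>O by (auto simp: mem_perp_iff dest: bspec[of _ _ 0])

  \<comment> \<open>\<open>perp T \<omega> UNIV\<close> is closed under coproducts in the ambient category, since all the classes
    \<open>perp T \<omega> {n<..}\<close> are.\<close>
  have "\<sigma>I \<in> perp T \<omega> {n<..}" for n
    by (rule closed_under_small_coproducts[OF perp_greaterThan_closed_under_coproducts[OF \<omega> \<omega>cl] small _ C])
      (use \<sigma>S in \<open>auto simp: S_def perp_def\<close>)
  then have \<sigma>IS: "\<sigma>I \<in> S" unfolding memS mem_perp_iff[OF \<omega>] using lt_ex by blast
  have \<sigma>\<sigma>: "\<sigma> \<in> perp T \<sigma> {0<..}" by (rule silting_full_sub_left_orth[OF S \<sigma>S' \<sigma>S \<sigma>W])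
  have \<sigma>IW: "orth \<sigma>I B" if "B \<in> perp T \<sigma> {..0}" for B
    by (rule orth_coproduct[OF C]) (rule \<sigma>W[OF that])
  have \<sigma>\<sigma>I: "\<sigma>I \<in> perp T \<sigma> {0<..}" by (rule silting_full_sub_left_orth[OF S \<sigma>S' \<sigma>IS \<sigma>IW])

  have \<sigma>I_orth: "orth \<sigma>I Y" if "orth \<sigma> Y" for Y
    by (rule orth_coproduct[OF C]) (rule that)
  have \<sigma>'_orth: "orth \<sigma>' Y" if "orth \<omega> Y" "orth \<sigma> Y" for Y
    using orth_middle_left[OF tr that(1) \<sigma>I_orth[OF that(2)]] .
  have \<omega>_orth: "orth \<omega> Y" if "orth \<sigma>' Y" "orth \<sigma> (Sh T Y)" "Y \<in> Ob T" for Y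
  proof -
    have "orth (Sh T \<omega>) (Sh T Y)"
      using orth_middle_left[OF triangle_rotate[OF triangle_rotate[OF tr]] \<sigma>I_orth[OF that(2)]]
        orth_Sh_iff[OF \<sigma>'O that(3)] that(1) by blast
    then show ?thesis using orth_Sh_iff \<omega> that(3) by blast
  qed
  have \<tau>_orth: "orth \<tau> Y \<longleftrightarrow> orth \<sigma>' Y \<and> orth \<sigma> Y" for Y
    by (rule orth_direct_sum_left[OF ds])

  \<comment> \<open>The silting class of \<open>\<tau>\<close> is the intersection of those of \<open>\<sigma>\<close> and \<open>\<omega>\<close>.\<close>
  have V: "perp T \<tau> {0<..} = perp T \<sigma> {0<..} \<inter> perp T \<omega> {0<..}"
  proof (rule set_eqI)
    fix Y
    have "(\<forall>i>0. orth \<tau> (shift T i Y)) \<longleftrightarrow>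
        (\<forall>i>0. orth \<sigma> (shift T i Y)) \<and> (\<forall>i>0. orth \<omega> (shift T i Y))" if Y: "Y \<in> Ob T"
    proof (intro iffI conjI allI impI)
      fix i :: int assume L: "\<forall>i>0. orth \<tau> (shift T i Y)" and i: "i > 0"
      show "orth \<sigma> (shift T i Y)" using L i \<tau>_orth by blast
      have "orth \<sigma> (shift T (i + 1) Y)" using L i \<tau>_orth by simp
      then have "orth \<sigma> (Sh T (shift T i Y))" using Y by (simp add: Sh_shift)
      then show "orth \<omega> (shift T i Y)" using \<omega>_orth L i \<tau>_orth Y by simp
    next
      fix i :: int assume "(\<forall>i>0. orth \<sigma> (shift T i Y)) \<and> (\<forall>i>0. orth \<omega> (shift T i Y))" "i > 0"
      then show "orth \<tau> (shift T i Y)" using \<tau>_orth \<sigma>'_orth by blast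
    qed
    then show "Y \<in> perp T \<tau> {0<..} \<longleftrightarrow> Y \<in> perp T \<sigma> {0<..} \<inter> perp T \<omega> {0<..}"
      using \<tau>O \<sigma>O \<omega> by (auto simp: mem_perp_iff Ball_def)
  qed

  have am: "a \<in> Hom T \<omega> \<sigma>'" "b \<in> Hom T \<sigma>' \<sigma>I" "\<alpha> \<in> Hom T \<sigma>I (Sh T \<omega>)"
    using tr by (auto simp: triangle_def)
  have \<sigma>'_right: "orth X (shift T i \<sigma>')"
    if "orth X (shift T i \<omega>)" "orth X (shift T i \<sigma>I)" "X \<in> Ob T" for X i
  proof -
    have "orth (shift T (- i) X) \<omega>" "orth (shift T (- i) X) \<sigma>I"
      using that orth_shift_right \<omega> \<sigma>IO by blast+
    then have "orth (shift T (- i) X) \<sigma>'" by (rule orth_middle_right[OF tr])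
    then show ?thesis using orth_shift_right that(3) \<sigma>'O by blast
  qed
  \<comment> \<open>In degree one, \<open>Hom(\<sigma>, \<sigma>'[1])\<close> vanishes because every map \<open>\<sigma> \<rightarrow> \<omega>[1]\<close> factors through \<open>\<alpha>\<close>.\<close>
  have one: "orth \<sigma> (Sh T \<sigma>')"
  proof (rule orthI)
    fix f assume f: "f \<in> Hom T \<sigma> (Sh T \<sigma>')"
    have t2: "triangle \<sigma>I (Sh T \<omega>) (Sh T \<sigma>') \<alpha> (Neg T (ShM T a)) (Neg T (ShM T b))"
      using triangle_rotate[OF triangle_rotate[OF tr]] .
    have "orth \<sigma> (Sh T \<sigma>I)" using \<sigma>\<sigma>I \<sigma>O \<sigma>IO by (auto simp: mem_perp_iff dest: bspec[of _ _ 1])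
    then have "Neg T (ShM T b) \<cdot> f = Zero T \<sigma> (Sh T \<sigma>I)"
      by (rule orthD) (use f am in \<open>simp add: Hom_iff\<close>)
    then obtain g where g: "g \<in> Hom T \<sigma> (Sh T \<omega>)" "f = Neg T (ShM T a) \<cdot> g"
      using weak_kernel[OF triangle_rotate[OF t2] f] by blast
    have i: "\<iota> g \<in> Hom T \<sigma> \<sigma>I" using coproduct_D(3)[OF C g(1)] .
    have "f = Neg T (ShM T a) \<cdot> (\<alpha> \<cdot> \<iota> g)" using g(2) \<alpha>[OF g(1)] by simp
    also have "\<dots> = (Neg T (ShM T a) \<cdot> \<alpha>) \<cdot> \<iota> g" using am i by (simp add: Hom_iff)
    also have "\<dots> = Zero T \<sigma> (Sh T \<sigma>')"
      using triangle_vanishing(1)[OF t2] i \<sigma>'O by (simp add: Hom_iff)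
    finally show "f = Zero T \<sigma> (Sh T \<sigma>')" .
  qed
  have "orth \<sigma> (shift T i \<sigma>')" if "i > 0" for i
  proof (cases "i = 1")
    case True
    then show ?thesis using one \<sigma>'O by simp
  next
    case False
    then show ?thesis
      using \<sigma>'_right[OF ext _ \<sigma>O, of i] \<sigma>\<sigma>I that \<sigma>O by (simp add: mem_perp_iff)
  qed
  then have "\<sigma>' \<in> perp T \<sigma> {0<..}" using \<sigma>O \<sigma>'O by (simp add: mem_perp_iff)
  moreover have "\<sigma>' \<in> perp T \<omega> {0<..}"
    using \<sigma>'_right[OF _ _ \<omega>] \<omega>V \<sigma>IS \<omega> \<sigma>'O by (simp add: mem_perp_iff memS)
  moreover have "\<sigma> \<in> perp T \<omega> {0<..}" using \<sigma>S by (auto simp: S_def perp_def)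
  moreover have "\<tau> \<in> perp T X I" if "\<sigma>' \<in> perp T X I" "\<sigma> \<in> perp T X I" "X \<in> Ob T" for X I
    using that \<tau>O \<sigma>O \<sigma>'O orth_direct_sum_right[OF ds] by (simp add: mem_perp_iff orth_shift_right)
  ultimately have \<tau>V: "\<tau> \<in> perp T \<tau> {0<..}" unfolding V using \<sigma>\<sigma> \<sigma>O \<omega> by blast

  have gen: "zero_object T Y" if Y: "Y \<in> perp T \<tau> UNIV" for Y
  proof -
    have YO: "Y \<in> Ob T" and o: "orth \<sigma>' (shift T i Y)" "orth \<sigma> (shift T i Y)" for i
      using Y \<tau>O \<tau>_orth by (auto simp: mem_perp_iff)
    have "orth \<omega> (shift T i Y)" for i
      using \<omega>_orth o(1)[of i] o(2)[of "i + 1"] YO by (simp add: Sh_shift)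
    then have "Y \<in> S" using memS YO by blast
    moreover have "Y \<in> perp T \<sigma> UNIV" using o(2) YO \<sigma>O by (simp add: mem_perp_iff)
    ultimately show ?thesis by (rule silting_full_sub_generates[OF S \<sigma>S'])
  qed
  show ?thesis
    using silting_criterion[OF hc sm inf \<tau>O \<tau>V _ gen] cl unfolding V by blast
qed

end

text \<open>It remains to see that \<open>\<sigma>\<close> and \<open>\<omega>\<close> are objects of the two outer categories, so that the
  inclusions fix them, and to translate hom-set equations into orthogonality.\<close>

theorem theorem2p10:
  fixes U :: "'u set"
    and D :: "('o, 'm) tricat"
    and \<omega> \<sigma> \<sigma>I \<sigma>' \<tau> :: 'o
    and \<iota> :: "'m \<Rightarrow> 'm"
    and \<alpha> a b :: 'm
    and i_us i_ls i_ush j_lsh j_us j_ls :: "('o, 'm, 'o, 'm) cat_functor"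
  defines "Y \<equiv> full_sub D (perp D \<omega> UNIV)"
    and "X \<equiv> full_sub D (Loc U D \<omega>)"
    and "I \<equiv> Hom D (FOb i_ls \<sigma>) (shift D 1 (FOb j_lsh \<omega>))"
  assumes "inaccessible U"
    and "well_generated U D"
    and "partial_silting U D \<omega>"
    and "recollement Y D X i_us i_ls i_ush j_lsh j_us j_ls"
    and "inclusion Y i_ls"
    and "inclusion X j_lsh"
    and "silting Y \<sigma>"
    and "closed_under_coproducts U D
           (perp D (FOb i_ls \<sigma>) {0<..} \<inter> perp D (FOb j_lsh \<omega>) {0<..})"
    and "\<forall>k \<ge> 2. Hom D (FOb i_ls \<sigma>) (shift D k (FOb j_lsh \<omega>)) =
           {Zero D (FOb i_ls \<sigma>) (shift D k (FOb j_lsh \<omega>))}"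
    and "coproduct D I (\<lambda>_. FOb i_ls \<sigma>) \<sigma>I \<iota>"
    and "\<alpha> \<in> Hom D \<sigma>I (shift D 1 (FOb j_lsh \<omega>))"
    and "\<forall>f \<in> I. Comp D \<alpha> (\<iota> f) = f"
    and "a \<in> Hom D (FOb j_lsh \<omega>) \<sigma>'"
    and "b \<in> Hom D \<sigma>' \<sigma>I"
    and "(a, b, \<alpha>) \<in> Tri D"
    and "direct_sum D \<sigma>' (FOb i_ls \<sigma>) \<tau>"
  shows "silting D \<tau>"
proof -
  note wg = assms(5)[unfolded well_generated_def]
  have tD: "triangulated_category D" using wg by (rule conjunct1)
  have hc: "has_coproducts U D" using wg[THEN conjunct2, THEN conjunct2] by (rule conjunct1)
  have sm: "small U (Hom D X Y)" if "X \<in> Ob D" "Y \<in> Ob D" for X Y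
    using wg[THEN conjunct2, THEN conjunct1] that by blast
  interpret triangulated_category D by (rule tD)
  have \<omega>O: "\<omega> \<in> Ob D" using assms(6) by (simp add: partial_silting_def perp_def)
  have "\<omega> \<in> Ob X" by (simp add: X_def full_sub_def Let_def Loc_def)
  then have j: "FOb j_lsh \<omega> = \<omega>" using assms(9) by (simp add: inclusion_def)
  have "\<sigma> \<in> Ob Y" using assms(10) by (simp add: silting_def)
  moreover from this have \<sigma>O: "\<sigma> \<in> Ob D" by (auto simp: Y_def full_sub_def Let_def perp_def)
  ultimately have i: "FOb i_ls \<sigma> = \<sigma>" using assms(8) by (simp add: inclusion_def)
  have I: "I = Hom D \<sigma> (Sh D \<omega>)" using \<omega>O by (simp add: I_def i j)
  have ext: "orth \<sigma> (shift D k \<omega>)" if "k \<ge> 2" for k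
    using assms(12) that \<sigma>O \<omega>O by (simp add: i j Hom_eq_Zero_iff)
  have tri: "triangle \<omega> \<sigma>' \<sigma>I a b \<alpha>"
    using assms(14,16-18) \<omega>O by (simp add: triangle_def j)
  have cl: "closed_under_coproducts U D (perp D \<sigma> {0<..} \<inter> perp D \<omega> {0<..})"
    using assms(11) by (simp only: i j)
  have C: "coproduct D (Hom D \<sigma> (Sh D \<omega>)) (\<lambda>_. \<sigma>) \<sigma>I \<iota>"
    using assms(13) by (simp only: i I)
  have can: "Comp D \<alpha> (\<iota> f) = f" if "f \<in> Hom D \<sigma> (Sh D \<omega>)" for f
    using assms(15) that by (simp add: I)
  have inf: "natLeq <o |U|" using assms(4) by (simp add: inaccessible_def)
  have ds: "direct_sum D \<sigma>' \<sigma> \<tau>" using assms(19) by (simp only: i)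
  show ?thesis
    by (rule silting_gluing[OF hc sm inf assms(6) assms(10)[unfolded Y_def] cl ext C can tri ds])
qed

end
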